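(* The following relations hold in $K[X]$. (1) Let $I\in H_u$, $J\in H_\xi$. Then $u(I)\xi(J)=p(I,J)$. (2) Let $I,I'\in H_u$ be not comparable. Then $u(I)u(I')=\sum_r b_r u(I_r)u(I'_r)$, $b_r\in K^*$, where for all $r$, $I_r\ge$ both $I,I'$, and $I'_r\le$ both $I,I'$ (with $I_r,I'_r\in H_u$). (3) Let $J,J'\in H_\xi$ be not comparable. Then $\xi(J)\xi(J')=\sum_s c_s\xi(J_s)\xi(J'_s)$, $c_s\in K^*$, where for all $s$, $J_s\ge$ both $J,J'$, and $J'_s\le$ both $J,J'$ (with $J_s,J'_s\in H_\xi$). (4) Let $(A_1,A_2),(B_1,B_2)\in H_p$ be not comparable. Then $p(A_1,A_2)p(B_1,B_2)=\sum_i a_i\,p(C_{i1},C_{i2})p(D_{i1},D_{i2})$, $a_i\in K^*$, where $(D_{i1},D_{i2})\in H_p$ and $(C_{i1},C_{i2})\in H_p\cup\{(\emptyset,\emptyset)\}$; further, for every $i$: (a) $C_{i1}\ge$ both $A_1$ and $B_1$, $D_{i1}\le$ both $A_1$ and $B_1$; (b) $C_{i2}\ge$ both $A_2$ and $B_2$, $D_{i2}\le$ both $A_2$ and $B_2$. (5) Let $I\in H_u$, $(A,B)\in H_p$ be such that $A\not\ge I$. Then $p(A,B)u(I)=\sum_t d_t\,p(A_t,B_t)u(I_t)$, $d_t\in K^*$, with $(A_t,B_t)\in H_p$, $I_t\in H_u$, where for every $t$: $A_t\ge$ both $A$ and $I$, $I_t\le$ both $A$ and $I$, and $B_t\ge B$.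 (6) Let $J\in H_\xi$, $(A,B)\in H_p$ be such that $B\not\ge J$. Then $p(A,B)\xi(J)=\sum_l e_l\,p(A_l,B_l)\xi(J_l)$, $e_l\in K^*$, with $(A_l,B_l)\in H_p$, $J_l\in H_\xi$, where for every $l$: $A_l\ge A$, $B_l\ge$ both $B$ and $J$, and $J_l\le$ both $B$ and $J$.
   Context: Let $K$ be an algebraically closed field of arbitrary characteristic, $V=K^n$, $m,q>n$, $X=V^{\oplus m}\oplus(V^* )^{\oplus q}$, with points $(\underline u,\underline\xi)=(u_1,\dots,u_m,\xi_1,\dots,\xi_q)$ and $\langle u_i,\xi_j\rangle=\xi_j(u_i)$. Fixing a basis of $V$, $X$ is identified with $M_{m,n}(K)\times M_{n,q}(K)$, a point being a pair $(U,W)$ where $u_i$ is the $i$-th row of $U$ and $\xi_j$ the $j$-th column of $W$. $I(r,k)$ is the set of strictly increasing $r$-tuples of elements of $\{1,\dots,k\}$. For $A=(a_1,\dots,a_r)\in I(r,k)$, $A'=(a'_1,\dots,a'_{r'})\in I(r',k)$ write $A\ge A'$ if $r\le r'$ and $a_j\ge a'_j$ for $1\le j\le r$; the empty set is $\ge$ everything. $H_u=I(n,m)$, $H_\xi=I(n,q)$, $H_p=\bigcup_{1\le r\le n}I(r,m)\times I(r,q)$. On $H_p$, $(A,B)\ge(A',B')$ iff $A\ge A'$ and $B\ge B'$. For $(A,B)\in H_p$, $p(A,B)$ is the function $\det(\langle u_i,\xi_j\rangle)_{i\in A,j\in B}$ on $X$, and $p(\emptyset,\emptyset)=1$; for $I\in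 H_u$, $u(I)$ is the $n$-minor of $U$ with rows $I$; for $J\in H_\xi$, $\xi(J)$ is the $n$-minor of $W$ with columns $J$. *)

theory Defs
  imports "Jordan_Normal_Form.Determinant"
begin

(* All index sets are 0-based: {1..k} is rendered as {..<k}, in accordance with rows and columns
   of matrices. The shift by one preserves the order of the indices, hence all order relations. *)

definition index_tuples :: "nat \<Rightarrow> nat \<Rightarrow> nat list set" where
  "index_tuples r k = {A. length A = r \<and> sorted_wrt (<) A \<and> set A \<subseteq> {..<k}}"

(* The relation A \<ge> A'. The longer tuple is the smaller one; in particular the empty tuple is
   \<ge> every tuple. *)
definition tuple_ge :: "nat list \<Rightarrow> nat list \<Rightarrow> bool"  (infix \<open>\<succeq>\<close> 50) where
  "A \<succeq> A' \<longleftrightarrow> length A \<le> length A' \<and> (\<forall>j<length A. A ! j \<ge> A' ! j)"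

definition pair_ge :: "nat list \<times> nat list \<Rightarrow> nat list \<times> nat list \<Rightarrow> bool"  (infix \<open>\<succeq>\<^sub>p\<close> 50) where
  "P \<succeq>\<^sub>p P' \<longleftrightarrow> fst P \<succeq> fst P' \<and> snd P \<succeq> snd P'"

definition H_u :: "nat \<Rightarrow> nat \<Rightarrow> nat list set" where
  "H_u n m = index_tuples n m"

definition H_xi :: "nat \<Rightarrow> nat \<Rightarrow> nat list set" where
  "H_xi n q = index_tuples n q"

definition H_p :: "nat \<Rightarrow> nat \<Rightarrow> nat \<Rightarrow> (nat list \<times> nat list) set" where
  "H_p n m q = (\<Union>r\<in>{1..n}. index_tuples r m \<times> index_tuples r q)"

(* A point of V^m + (V^* )^q, V = K^n, is a pair (U, W): the vectors u_i are the rows of U and the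
   covectors xi_j are the columns of W. Since K is infinite, elements of K[X] are identified with the functions on
   X they induce; an identity in K[X] is an identity at all points of X. *)
type_synonym 'k point = "'k mat \<times> 'k mat"

definition point_space :: "nat \<Rightarrow> nat \<Rightarrow> nat \<Rightarrow> 'k point set" where
  "point_space n m q = carrier_mat m n \<times> carrier_mat n q"

definition pairing :: "'k::comm_ring_1 point \<Rightarrow> nat \<Rightarrow> nat \<Rightarrow> 'k" where
  "pairing x i j = row (fst x) i \<bullet> col (snd x) j"

definition p :: "nat list \<Rightarrow> nat list \<Rightarrow> 'k::comm_ring_1 point \<Rightarrow> 'k" where
  "p A B x = det (mat (length A) (length B) (\<lambda>(i, j). pairing x (A ! i) (B ! j)))"

definition u :: "nat \<Rightarrow> nat list \<Rightarrow> 'k::comm_ring_1 point \<Rightarrow> 'k" where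
  "u n I x = det (mat n n (\<lambda>(i, j). fst x $$ (I ! i, j)))"

definition xi :: "nat \<Rightarrow> nat list \<Rightarrow> 'k::comm_ring_1 point \<Rightarrow> 'k"  (\<open>\<xi>\<close>) where
  "\<xi> n J x = det (mat n n (\<lambda>(i, j). snd x $$ (i, J ! j)))"

lemma p_empty: "p [] [] x = 1"
  by (simp add: p_def)

lemma empty_tuple_ge: "[] \<succeq> A"
  by (simp add: tuple_ge_def)

end

theory Submission
  imports Defs
begin

text \<open>
Relations (2) to (6) are instances of one identity. Let \<open>w\<close> be a family of \<open>n + r\<close> vectors of
\<open>K\<^sup>n\<close>, indexed by a set \<open>E\<close> of natural numbers, with \<open>r \<le> n\<close>, and let \<open>V\<close> be a linear map from
\<open>K\<^sup>n\<close> to \<open>K\<^sup>r\<close>. For an \<open>r\<close>-element subset \<open>S\<close> of \<open>E\<close> let \<open>G(S)\<close> be the product of the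
\<open>r\<close>-minor of the images under \<open>V\<close> of the vectors indexed by \<open>S\<close> and the \<open>n\<close>-minor of the vectors
indexed by \<open>E - S\<close>. Then \<open>G(S)\<close> is a linear combination, with coefficients independent of \<open>w\<close> and
\<open>V\<close>, of the products \<open>G(Q)\<close> such that \<open>Q\<close> lies above both \<open>S\<close> and \<open>E - S\<close>
(\<open>minor_product_straightening\<close>). Passing to complements reverses the order, so \<open>E - Q\<close> then
automatically lies below both.

Call \<open>Q\<close> standard if it lies above \<open>E - Q\<close>. If \<open>S\<close> is not standard, the elements of \<open>S\<close> below some
threshold and the elements of \<open>E - S\<close> above it are more than \<open>n\<close> in number. The Laplace
expansion of a determinant that vanishes for this reason expresses \<open>G(S)\<close> by products \<open>G(S')\<close> with
\<open>S'\<close> above \<open>S\<close> (\<open>minor_product_exchange\<close>). Iterating, the standard products span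
(\<open>spanned_by_standard_products\<close>), but this bounds \<open>Q\<close> only from one side.

The two-sided bound is read off from special values. For standard \<open>Q\<close>, place the \<open>k\<close>-th basis
vector both at the \<open>k\<close>-th element of \<open>Q\<close> and at the \<open>k\<close>-th element of \<open>E - Q\<close>. At this point
\<open>G(Q) = 1\<close>, while \<open>G(P) \<noteq> 0\<close> forces \<open>P\<close> and \<open>E - P\<close> to share each of the \<open>r\<close> pairs between
them; since \<open>Q\<close> takes the larger element of every pair, \<open>Q\<close> lies above \<open>P\<close> and above \<open>E - P\<close>
(\<open>standard_test_point\<close>). Now let \<open>Q\<close> be lowest among the indices that occur in an expansion of
\<open>G(S)\<close> into standard products. At the test point of \<open>Q\<close> every other term vanishes, hence
\<open>G(S) \<noteq> 0\<close> there, and so \<open>Q\<close> lies above \<open>S\<close> and \<open>E - S\<close>. Every index that occurs lies above such a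
lowest one.

Two tuples of row indices are merged into one set \<open>E\<close> by sending the entries of the first to even
and those of the second to odd numbers (\<open>tuple_straightening\<close>). With \<open>r = n\<close> and \<open>V\<close> the identity
this gives (2); with \<open>V\<close> the map whose coordinates are the covectors \<open>\<xi>\<^sub>b\<close>, \<open>b\<close> in \<open>B\<close>, it gives (5);
(3) and (6) are the transposed statements. For (4), the minors of an \<open>m\<close> by \<open>q\<close> matrix \<open>Z\<close> are, up to
sign, the maximal minors of \<open>Z\<close> with a reversed identity matrix attached below it, and the order on
pairs of tuples becomes the order on \<open>q\<close>-tuples of rows, so that (4) too follows from the case of
equal lengths (\<open>block_minor_straightening\<close>); minors of \<open>Z = U W\<close> of size greater than \<open>n\<close> vanish.
Relation (1) is the multiplicativity of the determinant.
\<close>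

section \<open>Minors and the generalised Laplace expansion\<close>

definition tuple_minor :: "(nat \<Rightarrow> nat \<Rightarrow> 'a::comm_ring_1) \<Rightarrow> nat list \<Rightarrow> 'a" where
  "tuple_minor w A = det (mat (length A) (length A) (\<lambda>(i, j). w (A ! i) j))"

definition set_minor :: "(nat \<Rightarrow> nat \<Rightarrow> 'a::comm_ring_1) \<Rightarrow> nat set \<Rightarrow> 'a" where
  "set_minor w S = tuple_minor w (sorted_list_of_set S)"

lemma strict_sorted_list_of_set_set:
  "sorted_wrt (<) (A :: nat list) \<Longrightarrow> sorted_list_of_set (set A) = A"
  by (metis finite_set set_sorted_list_of_set strict_sorted_equal strict_sorted_list_of_set)

lemma permutation_of_mset_eq:
  assumes "mset xs = mset ys"
  obtains p where "p permutes {0..<length ys}" "\<And>i. i < length ys \<Longrightarrow> xs ! i = ys ! p i"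
proof -
  from assms obtain p where p: "p permutes {..<length ys}" "permute_list p ys = xs"
    by (rule mset_eq_permutation)
  have "p permutes {0..<length ys}" using p(1) by (simp add: lessThan_atLeast0)
  moreover have "xs ! i = ys ! p i" if "i < length ys" for i
    using p that by (metis permute_list_nth)
  ultimately show ?thesis using that by blast
qed

lemma signof_square: "(signof \<pi> :: 'a::ring_1) * signof \<pi> = 1"
  by (metis mult_1 mult_minus1 of_int_1 of_int_minus sign_idempotent sign_def minus_minus)

text \<open>
The generalised Laplace expansion along the first \<open>n\<close> columns. In the permutation expansion of the
determinant, the permutations are grouped by the set \<open>S\<close> of rows that are matched with the last
\<open>r\<close> columns; each group is the determinant of a matrix that becomes block diagonal after a
permutation of the rows. The sign of that permutation depends on \<open>S\<close> only.
\<close>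

lemma laplace_expansion:
  fixes E :: "nat set"
  assumes "finite E" and "card E = n + r"
  shows "\<exists>\<epsilon> :: nat set \<Rightarrow> 'a::idom. (\<forall>S. \<epsilon> S * \<epsilon> S = 1) \<and>
    (\<forall>g h. det (mat (n + r) (n + r)
        (\<lambda>(i, j). if j < n then g (sorted_list_of_set E ! i) j else h (sorted_list_of_set E ! i) (j - n)))
      = (\<Sum>S | S \<subseteq> E \<and> card S = r. \<epsilon> S * (set_minor h S * set_minor g (E - S))))"
proof -
  define L where "L = sorted_list_of_set E"
  define N where "N = n + r"
  define G where "G = {S. S \<subseteq> E \<and> card S = r}"
  have lenL: "length L = N" and setL: "set L = E" and distL: "distinct L"
    using assms by (auto simp: L_def N_def)
  have "finite G" using assms(1) by (simp add: G_def)
  have card_compl: "card (E - S) = n" if "S \<in> G" for S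
    using that assms by (auto simp: G_def card_Diff_subset finite_subset)
  have "\<exists>\<sigma>. S \<in> G \<longrightarrow> \<sigma> permutes {0..<N} \<and>
      (\<forall>i<N. (sorted_list_of_set (E - S) @ sorted_list_of_set S) ! i = L ! \<sigma> i)" for S
  proof (cases "S \<in> G")
    case True
    then have S: "S \<subseteq> E" "finite S" using assms(1) finite_subset by (auto simp: G_def)
    have "mset (sorted_list_of_set (E - S) @ sorted_list_of_set S) = mset L"
    proof -
      have "distinct (sorted_list_of_set (E - S) @ sorted_list_of_set S)"
        using S assms(1) by auto
      moreover have "set (sorted_list_of_set (E - S) @ sorted_list_of_set S) = set L"
        using S assms(1) setL by auto
      ultimately show ?thesis using distL set_eq_iff_mset_eq_distinct by blast
    qed
    then show ?thesis using permutation_of_mset_eq lenL by metis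
  qed simp
  then obtain \<sigma> where \<sigma>: "\<And>S. S \<in> G \<Longrightarrow> \<sigma> S permutes {0..<N}"
    "\<And>S i. S \<in> G \<Longrightarrow> i < N \<Longrightarrow> (sorted_list_of_set (E - S) @ sorted_list_of_set S) ! i = L ! \<sigma> S i"
    by metis
  define \<epsilon> :: "nat set \<Rightarrow> 'a" where "\<epsilon> S = signof (\<sigma> S)" for S
  have \<epsilon>: "\<epsilon> S * \<epsilon> S = 1" for S by (simp only: \<epsilon>_def signof_square)
  have "det (mat N N (\<lambda>(i, j). if j < n then g (L ! i) j else h (L ! i) (j - n)))
      = (\<Sum>S\<in>G. \<epsilon> S * (set_minor h S * set_minor g (E - S)))" for g h :: "nat \<Rightarrow> nat \<Rightarrow> 'a"
  proof -
    define f where "f i j = (if j < n then g (L ! i) j else h (L ! i) (j - n))" for i j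
    define fS where "fS S i j = (if (L ! i \<in> S) = (n \<le> j) then f i j else 0)" for S i j
    \<comment> \<open>Exactly one \<open>S\<close> contributes: the set of rows that \<open>\<pi>\<close> matches with the last \<open>r\<close> columns.\<close>
    have split: "(\<Prod>i=0..<N. f i (\<pi> i)) = (\<Sum>S\<in>G. \<Prod>i=0..<N. fS S i (\<pi> i))"
      if \<pi>: "\<pi> permutes {0..<N}" for \<pi>
    proof -
      define I where "I = {i \<in> {0..<N}. n \<le> \<pi> i}"
      define T where "T = (!) L ` I"
      have bij: "bij_betw \<pi> {0..<N} {0..<N}" using \<pi> by (rule permutes_imp_bij)
      have "\<pi> ` I = {n..<N}"
      proof -
        have im: "\<pi> ` {0..<N} = {0..<N}" using bij by (simp add: bij_betw_def)
        have "\<exists>i<N. x = \<pi> i" if "x < N" for x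
        proof -
          have "x \<in> \<pi> ` {0..<N}" using that by (simp add: im)
          then show ?thesis by auto
        qed
        moreover have "\<pi> i < N" if "i < N" for i
          using im that by (metis atLeastLessThan_iff imageI le0)
        ultimately show ?thesis unfolding I_def by (auto simp: image_iff) (metis)
      qed
      moreover have "inj_on \<pi> I" using bij unfolding bij_betw_def I_def
        by (auto intro: inj_on_subset)
      ultimately have "card I = r" using card_image[of \<pi> I] by (simp add: N_def)
      moreover have "inj_on ((!) L) I"
        using distL lenL by (auto simp: I_def inj_on_def nth_eq_iff_index_eq)
      ultimately have "card T = r" by (simp add: T_def card_image)
      moreover have "T \<subseteq> E" using setL lenL by (auto simp: T_def I_def)
      ultimately have TG: "T \<in> G" by (simp add: G_def)
      have memT: "L ! i \<in> T \<longleftrightarrow> n \<le> \<pi> i" if "i < N" for i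
        using that distL lenL by (auto simp: T_def I_def nth_eq_iff_index_eq)
      have others: "(\<Sum>S\<in>G - {T}. \<Prod>i=0..<N. fS S i (\<pi> i)) = 0"
      proof (rule sum.neutral, rule ballI)
        fix S assume that: "S \<in> G - {T}"
        have "\<exists>i<N. (L ! i \<in> S) \<noteq> (n \<le> \<pi> i)"
        proof (rule ccontr)
          assume "\<not> ?thesis"
          then have *: "\<forall>i<N. L ! i \<in> S \<longleftrightarrow> L ! i \<in> T" using memT by blast
          have "x \<in> S \<longleftrightarrow> x \<in> T" if "x \<in> E" for x
            using that * setL lenL by (metis in_set_conv_nth)
          then have "S = T" using that TG by (auto simp: G_def)
          then show False using that by simp
        qed
        then show "(\<Prod>i=0..<N. fS S i (\<pi> i)) = 0" by (auto simp: fS_def intro!: prod_zero)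
      qed
      have "(\<Sum>S\<in>G. \<Prod>i=0..<N. fS S i (\<pi> i)) = (\<Prod>i=0..<N. fS T i (\<pi> i))"
        by (subst sum.remove[OF \<open>finite G\<close> TG]) (simp only: others add_0_right)
      also have "\<dots> = (\<Prod>i=0..<N. f i (\<pi> i))"
        using memT by (intro prod.cong) (auto simp: fS_def)
      finally show ?thesis by simp
    qed
    have perm_lt: "\<pi> i < N" if "\<pi> permutes {0..<N}" "i < N" for \<pi> i
      using that by (metis atLeastLessThan_iff le0 permutes_in_image)
    have "det (mat N N (\<lambda>(i, j). f i j))
        = (\<Sum>\<pi> | \<pi> permutes {0..<N}. signof \<pi> * (\<Prod>i=0..<N. f i (\<pi> i)))"
      by (subst det_def'[of _ N]) (auto intro!: sum.cong prod.cong simp: perm_lt)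
    also have "\<dots> = (\<Sum>\<pi> | \<pi> permutes {0..<N}. \<Sum>S\<in>G. signof \<pi> * (\<Prod>i=0..<N. fS S i (\<pi> i)))"
      by (intro sum.cong) (auto simp: split sum_distrib_left)
    also have "\<dots> = (\<Sum>S\<in>G. \<Sum>\<pi> | \<pi> permutes {0..<N}. signof \<pi> * (\<Prod>i=0..<N. fS S i (\<pi> i)))"
      by (rule sum.swap)
    also have "\<dots> = (\<Sum>S\<in>G. det (mat N N (\<lambda>(i, j). fS S i j)))"
      by (subst det_def'[of _ N]) (auto intro!: sum.cong prod.cong simp: perm_lt)
    also have "\<dots> = (\<Sum>S\<in>G. \<epsilon> S * (set_minor h S * set_minor g (E - S)))"
    proof (rule sum.cong[OF refl])
      fix S assume S: "S \<in> G"
      then have Sp: "S \<subseteq> E" "finite S" "card S = r"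
        using assms(1) finite_subset by (auto simp: G_def)
      define K where "K = sorted_list_of_set (E - S)"
      define R where "R = sorted_list_of_set S"
      have K: "length K = n" "set K = E - S" and R: "length R = r" "set R = S"
        using card_compl[OF S] Sp assms(1) by (auto simp: K_def R_def)
      have L\<sigma>: "L ! \<sigma> S i = (if i < n then K ! i else R ! (i - n))" if "i < N" for i
        using \<sigma>(2)[OF S that, symmetric] K(1)
        by (simp add: nth_append K_def[symmetric] R_def[symmetric])
      have "mat N N (\<lambda>(i, j). mat N N (\<lambda>(i, j). fS S i j) $$ (\<sigma> S i, j)) =
          four_block_mat (mat n n (\<lambda>(i, j). g (K ! i) j)) (0\<^sub>m n r) (0\<^sub>m r n)
            (mat r r (\<lambda>(i, j). h (R ! i) j))"
      proof (rule eq_matI)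
        fix i j
        assume "i < dim_row (four_block_mat (mat n n (\<lambda>(i, j). g (K ! i) j)) (0\<^sub>m n r) (0\<^sub>m r n)
            (mat r r (\<lambda>(i, j). h (R ! i) j)))"
          and "j < dim_col (four_block_mat (mat n n (\<lambda>(i, j). g (K ! i) j)) (0\<^sub>m n r) (0\<^sub>m r n)
            (mat r r (\<lambda>(i, j). h (R ! i) j)))"
        then have ij: "i < N" "j < N" by (auto simp: N_def)
        have inS: "(if i < n then K ! i else R ! (i - n)) \<in> S \<longleftrightarrow> n \<le> i"
        proof (cases "i < n")
          case True
          then have "K ! i \<in> E - S" using K nth_mem by metis
          with True show ?thesis by auto
        next
          case False
          then have "R ! (i - n) \<in> S" using R ij nth_mem[of "i - n" R] by (simp add: N_def)
          with False show ?thesis by auto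
        qed
        show "mat N N (\<lambda>(i, j). mat N N (\<lambda>(i, j). fS S i j) $$ (\<sigma> S i, j)) $$ (i, j) =
          four_block_mat (mat n n (\<lambda>(i, j). g (K ! i) j)) (0\<^sub>m n r) (0\<^sub>m r n)
            (mat r r (\<lambda>(i, j). h (R ! i) j)) $$ (i, j)"
          using ij perm_lt[OF \<sigma>(1)[OF S] ij(1)] inS
          by (auto simp: fS_def f_def L\<sigma> N_def split: if_splits)
      qed (auto simp: N_def)
      then have "signof (\<sigma> S) * det (mat N N (\<lambda>(i, j). fS S i j)) =
          det (mat n n (\<lambda>(i, j). g (K ! i) j)) * det (mat r r (\<lambda>(i, j). h (R ! i) j))"
        using det_permute_rows[OF _ \<sigma>(1)[OF S], of "mat N N (\<lambda>(i, j). fS S i j)"]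
          det_four_block_mat_upper_right_zero[of "mat n n (\<lambda>(i, j). g (K ! i) j)" n "0\<^sub>m n r" r "0\<^sub>m r n"
            "mat r r (\<lambda>(i, j). h (R ! i) j)"] by simp
      also have "\<dots> = set_minor h S * set_minor g (E - S)"
        unfolding set_minor_def tuple_minor_def using K R by (simp add: K_def[symmetric] R_def[symmetric])
      finally show "det (mat N N (\<lambda>(i, j). fS S i j)) = \<epsilon> S * (set_minor h S * set_minor g (E - S))"
        using \<epsilon>[of S] unfolding \<epsilon>_def by (metis mult.assoc mult_1)
    qed
    finally show ?thesis by (simp add: f_def)
  qed
  then show ?thesis unfolding N_def L_def G_def using \<epsilon> by blast
qed

lemma det_permute_columns:
  assumes "\<sigma> permutes {0..<n}"
  shows "det (mat n n (\<lambda>(i, j). f i (\<sigma> j))) = signof \<sigma> * (det (mat n n (\<lambda>(i, j). f i j)) :: 'a::comm_ring_1)"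
proof -
  let ?F = "mat n n (\<lambda>(i, j). f j i)"
  have \<sigma>: "\<sigma> i < n" if "i < n" for i
    using assms that by (metis atLeastLessThan_iff le0 permutes_in_image)
  have t1: "mat n n (\<lambda>(i, j). f i (\<sigma> j)) = transpose_mat (mat n n (\<lambda>(i, j). ?F $$ (\<sigma> i, j)))"
    by (rule eq_matI) (auto simp: \<sigma>)
  have t2: "mat n n (\<lambda>(i, j). f i j) = transpose_mat ?F" by (rule eq_matI) auto
  have "det (mat n n (\<lambda>(i, j). f i (\<sigma> j))) = det (mat n n (\<lambda>(i, j). ?F $$ (\<sigma> i, j)))"
    unfolding t1 by (rule det_transpose[of _ n]) simp
  also have "\<dots> = signof \<sigma> * det ?F" by (rule det_permute_rows[OF _ assms]) simp
  also have "det ?F = det (mat n n (\<lambda>(i, j). f i j))"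
    unfolding t2 by (rule det_transpose[symmetric, of _ n]) simp
  finally show ?thesis .
qed

lemma det_zero_row:
  assumes "k < n" and "\<And>j. j < n \<Longrightarrow> f k j = 0"
  shows "det (mat n n (\<lambda>(i, j). f i j)) = (0 :: 'a::comm_ring_1)"
proof -
  have "(\<Prod>i=0..<n. f i (\<pi> i)) = 0" if "\<pi> permutes {0..<n}" for \<pi>
  proof (rule prod_zero)
    have "\<pi> k < n" using that assms(1) by (metis atLeastLessThan_iff le0 permutes_in_image)
    then show "\<exists>i\<in>{0..<n}. f i (\<pi> i) = 0" using assms by (intro bexI[of _ k]) auto
  qed simp
  moreover have "(\<Prod>i=0..<n. mat n n (\<lambda>(i, j). f i j) $$ (i, \<pi> i)) = (\<Prod>i=0..<n. f i (\<pi> i))"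
    if "\<pi> permutes {0..<n}" for \<pi>
    using permutes_in_image[OF that] by (intro prod.cong) auto
  ultimately show ?thesis by (subst det_def'[of _ n]) (auto intro!: sum.neutral)
qed

lemma det_zero_column:
  assumes "k < n" and "\<And>i. i < n \<Longrightarrow> f i k = 0"
  shows "det (mat n n (\<lambda>(i, j). f i j)) = (0 :: 'a::comm_ring_1)"
proof -
  have "transpose_mat (mat n n (\<lambda>(i, j). f i j)) = mat n n (\<lambda>(i, j). f j i)"
    by (rule eq_matI) auto
  then show ?thesis
    using det_transpose[of "mat n n (\<lambda>(i, j). f i j)" n] det_zero_row[of k n "\<lambda>i j. f j i"] assms
    by simp
qed

lemma nth_sorted_list_of_set_mem: "finite S \<Longrightarrow> i < card S \<Longrightarrow> sorted_list_of_set S ! i \<in> S"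
  by (metis nth_mem set_sorted_list_of_set sorted_list_of_set.length_sorted_key_list_of_set)

lemma set_minor_cong:
  assumes "finite S" and "\<And>i j. i \<in> S \<Longrightarrow> j < card S \<Longrightarrow> w i j = w' i j"
  shows "set_minor w S = set_minor w' S"
  unfolding set_minor_def tuple_minor_def
  by (intro arg_cong[of _ _ det] eq_matI) (auto simp: assms nth_sorted_list_of_set_mem)

lemma set_minor_zero_row:
  assumes "finite S" and "z \<in> S" and "\<And>j. j < card S \<Longrightarrow> w z j = 0"
  shows "set_minor w S = 0"
proof -
  obtain k where "k < card S" "sorted_list_of_set S ! k = z"
    using assms(1,2) by (metis in_set_conv_nth set_sorted_list_of_set
        sorted_list_of_set.length_sorted_key_list_of_set)
  then show ?thesis unfolding set_minor_def tuple_minor_def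
    using assms by (intro det_zero_row[of k]) auto
qed

lemma set_minor_zero_column:
  assumes "finite S" and "k < card S" and "\<And>i. i \<in> S \<Longrightarrow> w i k = 0"
  shows "set_minor w S = 0"
  unfolding set_minor_def tuple_minor_def
  using assms by (intro det_zero_column[of k]) (auto simp: nth_sorted_list_of_set_mem)

section \<open>The dominance order on sets of indices\<close>

text \<open>
The relation \<open>\<succeq>\<close> on strictly increasing tuples, expressed by counting: \<open>S\<close> has at most as many
elements below each threshold as \<open>T\<close>. In this form passing to complements is a subtraction.
\<close>

definition dominates :: "nat set \<Rightarrow> nat set \<Rightarrow> bool" where
  "dominates S T \<longleftrightarrow> (\<forall>t. card (S \<inter> {..<t}) \<le> card (T \<inter> {..<t}))"

lemma dominates_refl: "dominates S S"
  by (simp add: dominates_def)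

lemma dominates_trans: "dominates R S \<Longrightarrow> dominates S T \<Longrightarrow> dominates R T"
  unfolding dominates_def using le_trans by blast

text \<open>
The Galois correspondence between the counting function of a set and its increasing enumeration;
it translates between the two descriptions of the order.
\<close>

lemma less_card_below_iff:
  assumes "sorted_wrt (<) (B :: nat list)"
  shows "j < card (set B \<inter> {..<t}) \<longleftrightarrow> j < length B \<and> B ! j < t"
  using assms
proof (induction B rule: rev_induct)
  case (snoc x B)
  then have sB: "sorted_wrt (<) B" and lt: "\<And>y. y \<in> set B \<Longrightarrow> y < x" and dB: "distinct (B @ [x])"
    by (auto simp: sorted_wrt_append strict_sorted_iff)
  show ?case
  proof (cases "x < t")
    case True
    then have "set (B @ [x]) \<inter> {..<t} = set (B @ [x])" using lt by fastforce
    then have "card (set (B @ [x]) \<inter> {..<t}) = Suc (length B)"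
      using distinct_card[OF dB] by simp
    moreover have "(B @ [x]) ! j < t" if "j < Suc (length B)"
      using that True lt[of "B ! j"] by (auto simp: nth_append less_Suc_eq)
    ultimately show ?thesis by auto
  next
    case False
    then have "set (B @ [x]) \<inter> {..<t} = set B \<inter> {..<t}" by auto
    then show ?thesis using snoc.IH[OF sB] False by (auto simp: nth_append less_Suc_eq)
  qed
qed simp

lemma tuple_ge_iff_dominates:
  assumes "sorted_wrt (<) A" and "sorted_wrt (<) B"
  shows "A \<succeq> B \<longleftrightarrow> dominates (set A) (set B)"
proof
  assume AB: "A \<succeq> B"
  show "dominates (set A) (set B)" unfolding dominates_def
  proof
    fix t
    have "j < card (set B \<inter> {..<t})" if "j < card (set A \<inter> {..<t})" for j
      using that AB unfolding less_card_below_iff[OF assms(1)] less_card_below_iff[OF assms(2)]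
      by (auto simp: tuple_ge_def intro: le_less_trans)
    then show "card (set A \<inter> {..<t}) \<le> card (set B \<inter> {..<t})" by (meson leI less_irrefl)
  qed
next
  assume "dominates (set A) (set B)"
  then have "j < length B \<and> B ! j < t" if "j < length A \<and> A ! j < t" for j t
    using that unfolding less_card_below_iff[OF assms(1), symmetric]
      less_card_below_iff[OF assms(2), symmetric] dominates_def by (meson less_le_trans)
  then have "j < length B \<and> B ! j \<le> A ! j" if "j < length A" for j
    using that by (metis less_Suc_eq_le lessI)
  then show "A \<succeq> B" unfolding tuple_ge_def by (meson leI less_irrefl)
qed

text \<open>
The area under the counting function, a measure for inductions and extremal choices: the higher a
set is in the dominance order, the less it weighs.
\<close>

definition weight :: "nat \<Rightarrow> nat set \<Rightarrow> nat" where
  "weight N S = (\<Sum>t\<le>N. card (S \<inter> {..<t}))"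

lemma weight_less:
  assumes "S \<subseteq> {..<N}" and "T \<subseteq> {..<N}" and "dominates S T" and "S \<noteq> T"
  shows "weight N S < weight N T"
  unfolding weight_def
proof (rule sum_strict_mono_ex1)
  show "\<forall>t\<in>{..N}. card (S \<inter> {..<t}) \<le> card (T \<inter> {..<t})"
    using assms(3) by (simp add: dominates_def)
  show "\<exists>t\<in>{..N}. card (S \<inter> {..<t}) < card (T \<inter> {..<t})"
  proof (rule ccontr)
    assume "\<not> ?thesis"
    with assms(3) have eq: "card (S \<inter> {..<t}) = card (T \<inter> {..<t})" if "t \<le> N" for t
      using that by (auto simp: dominates_def le_less)
    have step: "card (A \<inter> {..<Suc t}) = card (A \<inter> {..<t}) + (if t \<in> A then 1 else 0)" for A :: "nat set" and t
      by (auto simp: lessThan_Suc)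
    have "t \<in> S \<longleftrightarrow> t \<in> T" if "t < N" for t
      using eq[of t] eq[of "Suc t"] step[of S t] step[of T t] that by (auto split: if_splits)
    then have "S = T" using assms(1,2) by blast
    then show False using assms(4) by simp
  qed
qed simp

lemma dominates_complement:
  assumes "finite E" and "Q \<subseteq> E" and "S \<subseteq> E" and "dominates Q S"
  shows "dominates (E - S) (E - Q)"
  unfolding dominates_def
proof
  fix t
  have *: "card (E \<inter> {..<t}) = card (R \<inter> {..<t}) + card ((E - R) \<inter> {..<t})" if "R \<subseteq> E" for R
  proof -
    have "E \<inter> {..<t} = (R \<inter> {..<t}) \<union> ((E - R) \<inter> {..<t})" using that by blast
    then show ?thesis using that assms(1)
      by (simp only:) (subst card_Un_disjoint, auto)
  qed
  have "card (Q \<inter> {..<t}) \<le> card (S \<inter> {..<t})" using assms(4) by (simp add: dominates_def)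
  then show "card ((E - S) \<inter> {..<t}) \<le> card ((E - Q) \<inter> {..<t})"
    using *[OF assms(2)] *[OF assms(3)] by linarith
qed

text \<open>
A set that meets all the pairs \<open>{Q ! k, Q' ! k}\<close> has, below any threshold \<open>t\<close>, an element from each
pair whose larger member \<open>Q ! k\<close> is below \<open>t\<close>.
\<close>

lemma dominates_of_transversal:
  assumes "finite T" and "length Q = length Q'" and "sorted_wrt (<) Q" and "distinct Q'"
    and disj: "set Q \<inter> set Q' = {}"
    and le: "\<And>k. k < length Q \<Longrightarrow> Q' ! k \<le> Q ! k"
    and meet: "\<And>k. k < length Q \<Longrightarrow> Q ! k \<in> T \<or> Q' ! k \<in> T"
  shows "dominates (set Q) T"
  unfolding dominates_def
proof
  fix t
  \<comment> \<open>an element of \<open>T\<close> in the \<open>k\<close>-th pair\<close>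
  define e where "e k = (if Q ! k \<in> T then Q ! k else Q' ! k)" for k
  define K where "K = {..<card (set Q \<inter> {..<t})}"
  have K: "k < length Q" "Q ! k < t" if "k \<in> K" for k
    using that less_card_below_iff[OF assms(3)] by (auto simp: K_def)
  have "distinct Q" using assms(3) by (simp add: strict_sorted_iff)
  moreover have ne: "Q ! x \<noteq> Q' ! y" if "x < length Q" "y < length Q" for x y
    using that disj assms(2) by (metis disjoint_iff nth_mem)
  ultimately have "inj_on e K"
    using K assms(2,4) ne ne[symmetric] by (auto simp: inj_on_def e_def nth_eq_iff_index_eq)
  moreover have "e ` K \<subseteq> T \<inter> {..<t}"
    using K le meet by (fastforce simp: e_def intro: le_less_trans)
  ultimately have "card K \<le> card (T \<inter> {..<t})"
    using assms(1) by (intro card_inj_on_le) auto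
  then show "card (set Q \<inter> {..<t}) \<le> card (T \<inter> {..<t})" by (simp add: K_def)
qed

section \<open>Products of two minors: spanning by standard products\<close>

text \<open>
The image of the family \<open>w\<close> of vectors with \<open>n\<close> coordinates under the linear map with matrix \<open>V\<close>.
\<close>

definition push :: "nat \<Rightarrow> (nat \<Rightarrow> nat \<Rightarrow> 'a::comm_ring_1) \<Rightarrow> (nat \<Rightarrow> nat \<Rightarrow> 'a) \<Rightarrow> nat \<Rightarrow> nat \<Rightarrow> 'a" where
  "push n V w i j = (\<Sum>l<n. w i l * V l j)"

text \<open>
This is \<open>G(S)\<close> of the introduction.
\<close>

definition minor_product ::
    "nat \<Rightarrow> (nat \<Rightarrow> nat \<Rightarrow> 'a::comm_ring_1) \<Rightarrow> (nat \<Rightarrow> nat \<Rightarrow> 'a) \<Rightarrow> nat set \<Rightarrow> nat set \<Rightarrow> 'a" where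
  "minor_product n V w E S = set_minor (push n V w) S * set_minor w (E - S)"

text \<open>
The two matrices differ by a factor on the right that is block unitriangular with \<open>- V\<close> off the
diagonal, and so has determinant 1.
\<close>

lemma det_shear:
  fixes g h :: "nat \<Rightarrow> nat \<Rightarrow> 'a::idom"
  shows "det (mat (n + r) (n + r) (\<lambda>(i, j). if j < n then g (L ! i) j else h (L ! i) (j - n))) =
    det (mat (n + r) (n + r)
      (\<lambda>(i, j). if j < n then g (L ! i) j else h (L ! i) (j - n) - push n V g (L ! i) (j - n)))"
    (is "det ?M = det ?M'")
proof -
  define C where "C = four_block_mat (1\<^sub>m n) (mat n r (\<lambda>(l, j). - V l j)) (0\<^sub>m r n) (1\<^sub>m r)"
  have C: "C \<in> carrier_mat (n + r) (n + r)" by (simp add: C_def)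
  have "det C = 1" unfolding C_def
    by (subst det_four_block_mat_lower_left_zero[where n = n and m = r]) auto
  have "?M * C = ?M'"
  proof (rule eq_matI)
    fix i j assume "i < dim_row ?M'" and "j < dim_col ?M'"
    then have i: "i < n + r" and j: "j < n + r" by auto
    have "(?M * C) $$ (i, j) = (\<Sum>k=0..<n + r. ?M $$ (i, k) * C $$ (k, j))"
      using i j C by (simp add: scalar_prod_def)
    also have "\<dots> = (\<Sum>k=0..<n. ?M $$ (i, k) * C $$ (k, j)) + (\<Sum>k=n..<n + r. ?M $$ (i, k) * C $$ (k, j))"
      by (simp add: sum.atLeastLessThan_concat)
    also have "\<dots> = ?M' $$ (i, j)"
    proof (cases "j < n")
      case True
      have "(\<Sum>k=0..<n. ?M $$ (i, k) * C $$ (k, j)) = (\<Sum>k=0..<n. if k = j then g (L ! i) j else 0)"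
        using i True by (intro sum.cong) (auto simp: C_def)
      moreover have "(\<Sum>k=n..<n + r. ?M $$ (i, k) * C $$ (k, j)) = 0"
        using i True by (intro sum.neutral) (auto simp: C_def)
      ultimately show ?thesis using i True by simp
    next
      case False
      have "(\<Sum>k=0..<n. ?M $$ (i, k) * C $$ (k, j)) = (\<Sum>k=0..<n. - (g (L ! i) k * V k (j - n)))"
        using i j False by (intro sum.cong) (auto simp: C_def)
      moreover have "(\<Sum>k=n..<n + r. ?M $$ (i, k) * C $$ (k, j)) =
          (\<Sum>k=n..<n + r. if k = j then h (L ! i) (j - n) else 0)"
        using i j False by (intro sum.cong) (auto simp: C_def split: if_splits)
      ultimately show ?thesis using i j False
        by (simp add: push_def sum_negf lessThan_atLeast0)
    qed
    finally show "(?M * C) $$ (i, j) = ?M' $$ (i, j)" .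
  qed (auto simp: C_def)
  then have "det ?M' = det ?M * det C" using C det_mult[of ?M "n + r" C] by simp
  then show ?thesis using \<open>det C = 1\<close> by simp
qed

text \<open>
Choose a threshold \<open>t\<close> at which \<open>S\<close> violates standardness. The set \<open>Y\<close> of elements of \<open>S\<close> below
\<open>t\<close> and the set \<open>X\<close> of elements of \<open>E - S\<close> from \<open>t\<close> on together have more than \<open>n\<close> elements. Consider
the square matrix whose row at \<open>e\<close> is \<open>(w e, V (w e))\<close> for \<open>e\<close> in \<open>X \<union> Y\<close>, \<open>(0, V (w e))\<close> for the other
elements of \<open>S\<close> and \<open>(w e, 0)\<close> for the other elements of \<open>E - S\<close>. Its determinant is zero, since
column operations turn the rows in \<open>X \<union> Y\<close> into \<open>(w e, 0)\<close>, and more than \<open>n\<close> rows then live in \<open>n\<close>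
columns. The terms of its Laplace expansion are the products for the sets \<open>S'\<close> that arise from \<open>S\<close>
by trading elements of \<open>Y\<close> for as many, larger, elements of \<open>X\<close>.
\<close>

lemma minor_product_exchange:
  fixes E :: "nat set"
  assumes "finite E" and "card E = n + r" and S: "S \<subseteq> E" "card S = r"
    and nonstandard: "\<not> dominates S (E - S)"
  shows "\<exists>c. \<forall>(w :: nat \<Rightarrow> nat \<Rightarrow> 'a::idom) V. minor_product n V w E S =
    (\<Sum>S' | S' \<subseteq> E \<and> card S' = r \<and> dominates S' S \<and> S' \<noteq> S. c S' * minor_product n V w E S')"
proof -
  obtain t where t: "card ((E - S) \<inter> {..<t}) < card (S \<inter> {..<t})"
    using nonstandard by (auto simp: dominates_def not_le)
  define Y where "Y = S \<inter> {..<t}"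
  define X where "X = (E - S) - {..<t}"
  define G where "G = {S'. S' \<subseteq> E \<and> card S' = r}"
  define J where "J = {S' \<in> G. S - Y \<subseteq> S' \<and> S' \<subseteq> S \<union> X}"
  define D where "D = {S'. S' \<subseteq> E \<and> card S' = r \<and> dominates S' S \<and> S' \<noteq> S}"
  have finS: "finite S'" if "S' \<in> G" for S'
    using that assms(1) unfolding G_def by (blast intro: finite_subset)
  have SG: "S \<in> G" using S by (simp add: G_def)
  then have finS0: "finite S" by (rule finS)
  have card_compl: "card (E - S') = n" if "S' \<in> G" for S'
    using that finS[OF that] assms(2) by (simp add: G_def card_Diff_subset)
  have "card (X \<union> Y) > n"
  proof -
    have "card (E - S) = card ((E - S) \<inter> {..<t}) + card X"
      using assms(1) unfolding X_def by (subst card_Int_Diff[of _ "{..<t}"]) auto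
    moreover have "card (X \<union> Y) = card X + card Y"
      using assms(1) finS0 by (intro card_Un_disjoint) (auto simp: X_def Y_def)
    ultimately show ?thesis using t card_compl[OF SG] by (simp add: Y_def)
  qed
  have meets: "S' \<inter> (X \<union> Y) \<noteq> {}" if "S' \<in> G" for S'
  proof
    assume "S' \<inter> (X \<union> Y) = {}"
    then have "X \<union> Y \<subseteq> E - S'" using S by (auto simp: X_def Y_def)
    then have "card (X \<union> Y) \<le> n" using card_compl[OF that] assms(1) by (metis card_mono finite_Diff)
    then show False using \<open>card (X \<union> Y) > n\<close> by simp
  qed
  have "J - {S} \<subseteq> D"
  proof
    fix S' assume "S' \<in> J - {S}"
    then have S': "S' \<subseteq> E" "card S' = r" "S - Y \<subseteq> S'" "S' \<subseteq> S \<union> X" "S' \<noteq> S" "finite S'"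
      using finS[of S'] by (auto simp: J_def G_def)
    have "card (S' \<inter> {..<t'}) \<le> card (S \<inter> {..<t'})" for t'
    proof (cases "t' \<le> t")
      case True
      then have "S' \<inter> {..<t'} \<subseteq> S \<inter> {..<t'}" using S' by (auto simp: X_def)
      then show ?thesis using finS0 by (simp add: card_mono)
    next
      case False
      then have "S - {..<t'} \<subseteq> S' - {..<t'}" using S' by (auto simp: Y_def)
      then have "card (S - {..<t'}) \<le> card (S' - {..<t'})" using S' by (simp add: card_mono)
      moreover have "card S = card (S \<inter> {..<t'}) + card (S - {..<t'})"
        using finS0 by (rule card_Int_Diff)
      moreover have "card S' = card (S' \<inter> {..<t'}) + card (S' - {..<t'})"
        using S'(6) by (rule card_Int_Diff)
      ultimately show ?thesis using S S' by simp
    qed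
    then show "S' \<in> D" using S' by (simp add: D_def dominates_def)
  qed
  from laplace_expansion[OF assms(1,2), where ?'a = 'a, folded G_def]
  obtain \<epsilon> :: "nat set \<Rightarrow> 'a" where \<epsilon>_laplace: "(\<forall>S. \<epsilon> S * \<epsilon> S = 1) \<and> (\<forall>g h. det (mat (n + r) (n + r)
        (\<lambda>(i, j). if j < n then g (sorted_list_of_set E ! i) j else h (sorted_list_of_set E ! i) (j - n)))
      = (\<Sum>S\<in>G. \<epsilon> S * (set_minor h S * set_minor g (E - S))))"
    by (rule exE)
  note \<epsilon> = spec[OF conjunct1[OF \<epsilon>_laplace]]
    and laplace = spec[OF spec[OF conjunct2[OF \<epsilon>_laplace]]]
  \<comment> \<open>Only the sets in \<open>J\<close>, obtained from \<open>S\<close> by trading part of \<open>Y\<close> for part of \<open>X\<close>, occur in the expansion.\<close>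
  define c where "c S' = (if S' \<in> J then - (\<epsilon> S * \<epsilon> S') else 0)" for S'
  have "minor_product n V w E S = (\<Sum>S'\<in>D. c S' * minor_product n V w E S')"
    for V and w :: "nat \<Rightarrow> nat \<Rightarrow> 'a"
  proof -
    define g where "g i j = (if i \<in> S - Y then 0 else w i j)" for i j
    define h where "h i j = (if i \<in> (E - S) - X then 0 else push n V w i j)" for i j
    have "(\<Sum>S'\<in>G. \<epsilon> S' * (set_minor h S' * set_minor g (E - S'))) =
      (\<Sum>S'\<in>G. \<epsilon> S' * (set_minor (\<lambda>i j. h i j - push n V g i j) S' * set_minor g (E - S')))"
      unfolding laplace[symmetric] by (rule det_shear)
    also have "\<dots> = 0"
    proof (intro sum.neutral ballI)
      fix S' assume S': "S' \<in> G"
      then obtain z where z: "z \<in> S'" "z \<in> X \<union> Y" using meets by blast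
      have "h z j - push n V g z j = 0" for j
        using z(2) S by (auto simp: h_def push_def g_def X_def Y_def)
      then have "set_minor (\<lambda>i j. h i j - push n V g i j) S' = 0"
        using finS[OF S'] z(1) by (intro set_minor_zero_row[of _ z]) auto
      then show "\<epsilon> S' * (set_minor (\<lambda>i j. h i j - push n V g i j) S' * set_minor g (E - S')) = 0"
        by simp
    qed
    finally have "0 = (\<Sum>S'\<in>G. \<epsilon> S' * (set_minor h S' * set_minor g (E - S')))" by simp
    also have "\<dots> = (\<Sum>S'\<in>J. \<epsilon> S' * minor_product n V w E S')"
    proof (rule sum.mono_neutral_cong_right)
      show "finite G" using assms(1) by (simp add: G_def)
      show "\<forall>S'\<in>G - J. \<epsilon> S' * (set_minor h S' * set_minor g (E - S')) = 0"
      proof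
        fix S' assume S': "S' \<in> G - J"
        then consider z where "z \<in> S'" "z \<in> (E - S) - X" | z where "z \<in> E - S'" "z \<in> S - Y"
          using S by (auto simp: J_def G_def)
        then show "\<epsilon> S' * (set_minor h S' * set_minor g (E - S')) = 0"
        proof cases
          case 1
          then have "set_minor h S' = 0"
            using finS[of S'] S' by (intro set_minor_zero_row[of _ z]) (auto simp: h_def)
          then show ?thesis by simp
        next
          case 2
          then have "set_minor g (E - S') = 0"
            using assms(1) by (intro set_minor_zero_row[of _ z]) (auto simp: g_def)
          then show ?thesis by simp
        qed
      qed
      fix S' assume S': "S' \<in> J"
      then have "set_minor h S' = set_minor (push n V w) S'"
        using finS[of S'] by (intro set_minor_cong) (auto simp: J_def h_def)
      moreover have "set_minor g (E - S') = set_minor w (E - S')"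
        using S' assms(1) by (intro set_minor_cong) (auto simp: J_def g_def)
      ultimately show "\<epsilon> S' * (set_minor h S' * set_minor g (E - S')) = \<epsilon> S' * minor_product n V w E S'"
        by (simp add: minor_product_def)
    qed (auto simp: J_def)
    also have "\<dots> = \<epsilon> S * minor_product n V w E S + (\<Sum>S'\<in>J - {S}. \<epsilon> S' * minor_product n V w E S')"
      using SG assms(1) by (intro sum.remove) (auto simp: J_def G_def)
    finally have "\<epsilon> S * (\<epsilon> S * minor_product n V w E S) =
        \<epsilon> S * - (\<Sum>S'\<in>J - {S}. \<epsilon> S' * minor_product n V w E S')"
      by (metis eq_neg_iff_add_eq_0)
    then have "minor_product n V w E S = (\<Sum>S'\<in>J - {S}. c S' * minor_product n V w E S')"
      by (simp add: mult.assoc[symmetric] \<epsilon> sum_distrib_left c_def sum_negf)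
    also have "\<dots> = (\<Sum>S'\<in>D. c S' * minor_product n V w E S')"
      using \<open>J - {S} \<subseteq> D\<close> assms(1)
      by (intro sum.mono_neutral_left) (auto simp: D_def c_def)
    finally show ?thesis .
  qed
  then show ?thesis unfolding D_def by blast
qed

text \<open>
The exchange relation is iterated; it terminates because every exchange lowers the weight.
\<close>

lemma spanned_by_standard_products:
  fixes E :: "nat set"
  assumes "finite E" and "card E = n + r" and "S \<subseteq> E" and "card S = r"
  shows "\<exists>c. \<forall>(w :: nat \<Rightarrow> nat \<Rightarrow> 'a::idom) V. minor_product n V w E S =
    (\<Sum>Q | Q \<subseteq> E \<and> card Q = r \<and> dominates Q (E - Q). c Q * minor_product n V w E Q)"
proof -
  obtain N where N: "E \<subseteq> {..<N}" using assms(1) finite_nat_iff_bounded by blast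
  define Std where "Std = {Q. Q \<subseteq> E \<and> card Q = r \<and> dominates Q (E - Q)}"
  have finStd: "finite Std" using assms(1) by (simp add: Std_def)
  show ?thesis using assms(3,4) unfolding Std_def[symmetric]
  proof (induction "weight N S" arbitrary: S rule: less_induct)
    case less
    show ?case
    proof (cases "dominates S (E - S)")
      case True
      then have "S \<in> Std" using less.prems by (simp add: Std_def)
      then have "minor_product n V w E S =
          (\<Sum>Q\<in>Std. (if Q = S then 1 else 0) * minor_product n V w E Q)" for V and w :: "nat \<Rightarrow> nat \<Rightarrow> 'a"
        using finStd by (simp add: if_distrib[of "\<lambda>x. x * _"] cong: if_cong)
      then show ?thesis by (intro exI[of _ "\<lambda>Q. if Q = S then 1 else 0"]) blast
    next
      case False
      define D where "D = {S'. S' \<subseteq> E \<and> card S' = r \<and> dominates S' S \<and> S' \<noteq> S}"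
      obtain c :: "nat set \<Rightarrow> 'a" where c: "\<And>w V. minor_product n V w E S = (\<Sum>S'\<in>D. c S' * minor_product n V w E S')"
        using minor_product_exchange[OF assms(1,2) less.prems False] unfolding D_def by blast
      have "\<exists>d. \<forall>(w :: nat \<Rightarrow> nat \<Rightarrow> 'a) V.
          minor_product n V w E S' = (\<Sum>Q\<in>Std. d Q * minor_product n V w E Q)" if "S' \<in> D" for S'
        using that less.prems N by (intro less.hyps weight_less) (auto simp: D_def)
      then obtain d :: "nat set \<Rightarrow> nat set \<Rightarrow> 'a" where d: "\<And>S' w V. S' \<in> D \<Longrightarrow>
          minor_product n V w E S' = (\<Sum>Q\<in>Std. d S' Q * minor_product n V w E Q)" by metis
      have "minor_product n V w E S =
          (\<Sum>Q\<in>Std. (\<Sum>S'\<in>D. c S' * d S' Q) * minor_product n V w E Q)" for V and w :: "nat \<Rightarrow> nat \<Rightarrow> 'a"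
      proof -
        have "minor_product n V w E S = (\<Sum>S'\<in>D. \<Sum>Q\<in>Std. c S' * d S' Q * minor_product n V w E Q)"
          by (subst c) (auto simp: d sum_distrib_left mult.assoc intro!: sum.cong)
        also have "\<dots> = (\<Sum>Q\<in>Std. \<Sum>S'\<in>D. c S' * d S' Q * minor_product n V w E Q)"
          by (rule sum.swap)
        finally show ?thesis by (simp add: sum_distrib_right)
      qed
      then show ?thesis by (intro exI[of _ "\<lambda>Q. \<Sum>S'\<in>D. c S' * d S' Q"]) blast
    qed
  qed
qed

section \<open>Products of two minors: the bounds on the support\<close>

text \<open>
At the point described in the introduction both factors of \<open>G(Q)\<close> are determinants of identity
matrices. If \<open>G(P) \<noteq> 0\<close>, none of the first \<open>r\<close> columns vanishes in either factor, so that both \<open>P\<close> and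
\<open>E - P\<close> meet every pair.
\<close>

lemma standard_test_point:
  fixes E :: "nat set"
  assumes "finite E" and "card E = n + r" and "r \<le> n"
    and Q: "Q \<subseteq> E" "card Q = r" "dominates Q (E - Q)"
  shows "\<exists>(w :: nat \<Rightarrow> nat \<Rightarrow> 'a::idom) V. minor_product n V w E Q = 1 \<and>
    (\<forall>P. P \<subseteq> E \<and> card P = r \<and> minor_product n V w E P \<noteq> 0 \<longrightarrow> dominates Q P \<and> dominates Q (E - P))"
proof -
  define L where "L = sorted_list_of_set Q"
  define L' where "L' = sorted_list_of_set (E - Q)"
  define w :: "nat \<Rightarrow> nat \<Rightarrow> 'a" where
    "w i j = (if j < r \<and> i = L ! j \<or> j < n \<and> i = L' ! j then 1 else 0)" for i j
  define V :: "nat \<Rightarrow> nat \<Rightarrow> 'a" where "V l j = (if l = j then 1 else 0)" for l j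
  have finQ: "finite Q" using Q(1) assms(1) finite_subset by blast
  then have cQ: "card (E - Q) = n" using Q assms(2) by (simp add: card_Diff_subset)
  have L: "length L = r" "set L = Q" "sorted_wrt (<) L" "distinct L"
    using Q finQ by (auto simp: L_def)
  have L': "length L' = n" "set L' = E - Q" "sorted_wrt (<) L'" "distinct L'"
    using assms(1) cQ by (auto simp: L'_def)
  have ne: "L ! i \<noteq> L' ! j" if "i < r" "j < n" for i j
    using that L L' by (metis DiffD2 nth_mem)
  have le: "L' ! k \<le> L ! k" if "k < r" for k
    using Q(3) L L' that tuple_ge_iff_dominates[of L L'] by (simp add: tuple_ge_def)
  have push: "push n V w i j = w i j" if "j < n" for i j
    using that by (simp add: push_def V_def if_distrib[of "\<lambda>x. _ * x"] cong: if_cong)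
  have product: "minor_product n V w E P = set_minor w P * set_minor w (E - P)"
    if "P \<subseteq> E" "card P = r" for P
  proof -
    have "finite P" using that(1) assms(1) finite_subset by blast
    then have "set_minor (push n V w) P = set_minor w P"
      using that assms(3) by (intro set_minor_cong) (auto simp: push)
    then show ?thesis by (simp add: minor_product_def)
  qed
  have "set_minor w Q = det (1\<^sub>m r)"
    unfolding set_minor_def tuple_minor_def L_def[symmetric]
    using L ne assms(3) by (intro arg_cong[of _ _ det] eq_matI) (auto simp: w_def nth_eq_iff_index_eq)
  moreover have "set_minor w (E - Q) = det (1\<^sub>m n)"
    unfolding set_minor_def tuple_minor_def L'_def[symmetric]
    using L' ne[symmetric] by (intro arg_cong[of _ _ det] eq_matI) (auto simp: w_def nth_eq_iff_index_eq)
  ultimately have "minor_product n V w E Q = 1" using Q by (simp add: product)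
  moreover have "dominates Q P \<and> dominates Q (E - P)"
    if P: "P \<subseteq> E" "card P = r" "minor_product n V w E P \<noteq> 0" for P
  proof -
    have finP: "finite P" using P(1) assms(1) finite_subset by blast
    then have cP: "card (E - P) = n" using P assms(2) by (simp add: card_Diff_subset)
    have nz: "set_minor w P \<noteq> 0" "set_minor w (E - P) \<noteq> 0" using P product by auto
    have meet: "L ! k \<in> T \<or> L' ! k \<in> T"
      if "finite T" "set_minor w T \<noteq> 0" "r \<le> card T" "k < r" for T k
    proof (rule ccontr)
      assume "\<not> ?thesis"
      then have "set_minor w T = 0"
        using that by (intro set_minor_zero_column[of _ k]) (auto simp: w_def)
      then show False using that by simp
    qed
    have "dominates (set L) T" if "finite T" "set_minor w T \<noteq> 0" "r \<le> card T" for T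
    proof (rule dominates_of_transversal[of T L "take r L'"])
      show "set L \<inter> set (take r L') = {}" using L L' by (auto dest: in_set_takeD)
    qed (use that L L' le meet[OF that] assms(3) in auto)
    then show ?thesis using nz finP cP P assms(1,3) L by simp
  qed
  ultimately show ?thesis by blast
qed

text \<open>
The coefficients are those of an expansion into standard products; what has to be shown is that all
indices in its support lie above \<open>S\<close> and \<open>E - S\<close>. Below any index \<open>R\<close> of the support there is a lowest
one, \<open>P\<close>, and evaluation at the test point of \<open>P\<close> isolates its coefficient.
\<close>

theorem minor_product_straightening:
  fixes E :: "nat set"
  assumes "finite E" and "card E = n + r" and "r \<le> n" and "S \<subseteq> E" and "card S = r"
  shows "\<exists>c. \<forall>(w :: nat \<Rightarrow> nat \<Rightarrow> 'a::idom) V. minor_product n V w E S =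
    (\<Sum>Q | Q \<subseteq> E \<and> card Q = r \<and> dominates Q S \<and> dominates Q (E - S). c Q * minor_product n V w E Q)"
proof -
  obtain N where N: "E \<subseteq> {..<N}" using assms(1) finite_nat_iff_bounded by blast
  define Std where "Std = {Q. Q \<subseteq> E \<and> card Q = r \<and> dominates Q (E - Q)}"
  have finStd: "finite Std" using assms(1) by (simp add: Std_def)
  obtain c :: "nat set \<Rightarrow> 'a" where
    c: "\<And>w V. minor_product n V w E S = (\<Sum>Q\<in>Std. c Q * minor_product n V w E Q)"
    using spanned_by_standard_products[OF assms(1,2,4,5)] unfolding Std_def by blast
  define Supp where "Supp = {Q \<in> Std. c Q \<noteq> 0}"
  have bound: "dominates R S \<and> dominates R (E - S)" if R: "R \<in> Supp" for R
  proof -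
    define M where "M = {P \<in> Supp. dominates R P}"
    have "finite M" "R \<in> M" using finStd R by (auto simp: M_def Supp_def dominates_refl)
    \<comment> \<open>Maximal weight means lowest position, so \<open>P\<close> is a lowest index of the support below \<open>R\<close>.\<close>
    then have "Max (weight N ` M) \<in> weight N ` M" by (intro Max_in) auto
    then obtain P where P: "P \<in> M" and Pmax: "weight N P = Max (weight N ` M)" by auto
    have max: "weight N P' \<le> weight N P" if "P' \<in> M" for P'
      using that \<open>finite M\<close> by (simp add: Pmax)
    have P': "P \<in> Std" "c P \<noteq> 0" "dominates R P" using P by (auto simp: M_def Supp_def)
    then obtain w V where test: "minor_product n V w E P = (1 :: 'a)"
      and test_nz: "\<And>P'. P' \<subseteq> E \<Longrightarrow> card P' = r \<Longrightarrow> minor_product n V w E P' \<noteq> 0 \<Longrightarrow>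
        dominates P P' \<and> dominates P (E - P')"
      using standard_test_point[OF assms(1-3), of P] unfolding Std_def by blast
    have "c P' * minor_product n V w E P' = 0" if "P' \<in> Std - {P}" for P'
    proof (rule ccontr)
      assume nz: "c P' * minor_product n V w E P' \<noteq> 0"
      then have "dominates P P'" using test_nz that by (auto simp: Std_def)
      moreover from this have "P' \<in> M"
        using nz that P'(3) dominates_trans by (auto simp: M_def Supp_def)
      ultimately show False
        using max[of P'] weight_less[of P N P'] that P'(1) N by (auto simp: Std_def)
    qed
    then have "minor_product n V w E S = c P"
      unfolding c sum.remove[OF finStd P'(1)] by (simp add: test sum.neutral)
    then have "dominates P S \<and> dominates P (E - S)"
      using test_nz[OF assms(4,5)] P'(2) by simp
    then show ?thesis using P'(3) dominates_trans by blast
  qed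
  define T where "T = {Q. Q \<subseteq> E \<and> card Q = r \<and> dominates Q S \<and> dominates Q (E - S)}"
  define c' where "c' Q = (if Q \<in> Std then c Q else 0)" for Q
  have "minor_product n V w E S = (\<Sum>Q\<in>T. c' Q * minor_product n V w E Q)"
    for V and w :: "nat \<Rightarrow> nat \<Rightarrow> 'a"
  proof -
    have "minor_product n V w E S = (\<Sum>Q\<in>Supp. c Q * minor_product n V w E Q)"
      unfolding c using finStd by (intro sum.mono_neutral_right) (auto simp: Supp_def)
    also have "\<dots> = (\<Sum>Q\<in>T. c' Q * minor_product n V w E Q)"
      using assms(1) bound
      by (intro sum.mono_neutral_cong_left) (auto simp: T_def Supp_def Std_def c'_def)
    finally show ?thesis .
  qed
  then show ?thesis unfolding T_def[symmetric] by (intro exI[of _ c'] allI)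
qed

section \<open>Straightening for tuples\<close>

lemma sorted_wrt_index_tuples: "A \<in> index_tuples r k \<Longrightarrow> sorted_wrt (<) A"
  by (simp add: index_tuples_def)

lemma set_minor_comp: "set_minor (\<lambda>e. w (f e)) S = tuple_minor w (map f (sorted_list_of_set S))"
  unfolding set_minor_def tuple_minor_def by (intro arg_cong[of _ _ det] eq_matI) auto

lemma tuple_minor_cong:
  assumes "\<And>i j. i \<in> set A \<Longrightarrow> j < length A \<Longrightarrow> w i j = w' i j"
  shows "tuple_minor w A = tuple_minor w' A"
  unfolding tuple_minor_def by (intro arg_cong[of _ _ det] eq_matI) (auto simp: assms)

lemma distinct_if_tuple_minor:
  assumes "tuple_minor w A \<noteq> 0"
  shows "distinct A"
proof (rule ccontr)
  assume "\<not> distinct A"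
  then obtain i j where "i < length A" "j < length A" "i \<noteq> j" "A ! i = A ! j"
    by (auto simp: distinct_conv_nth)
  then have "tuple_minor w A = 0" unfolding tuple_minor_def
    by (intro det_identical_rows[of _ "length A" i j]) (auto intro!: eq_vecI)
  then show False using assms by simp
qed

lemma tuple_ge_map: "mono f \<Longrightarrow> A \<succeq> B \<Longrightarrow> map f A \<succeq> map f B"
  by (auto simp: tuple_ge_def mono_def)

text \<open>
Terms with the same index are added up and those with coefficient zero are dropped. This produces
sums over sets of indices with nonzero coefficients from sums over any parametrisation.
\<close>

lemma collect_terms:
  fixes c :: "'i \<Rightarrow> 'a::comm_ring_1" and \<phi> :: "'i \<Rightarrow> 's"
  assumes "finite T"
  shows "\<exists>S b. finite S \<and> S \<subseteq> \<phi> ` T \<and> (\<forall>s\<in>S. b s \<noteq> 0) \<and>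
    (\<forall>h. (\<Sum>i\<in>T. c i * h (\<phi> i)) = (\<Sum>s\<in>S. b s * h s))"
proof -
  define b where "b s = (\<Sum>i | i \<in> T \<and> \<phi> i = s. c i)" for s
  define S where "S = {s \<in> \<phi> ` T. b s \<noteq> 0}"
  have "(\<Sum>i\<in>T. c i * h (\<phi> i)) = (\<Sum>s\<in>S. b s * h s)" for h :: "'s \<Rightarrow> 'a"
  proof -
    have "(\<Sum>i\<in>T. c i * h (\<phi> i)) = (\<Sum>s\<in>\<phi> ` T. \<Sum>i | i \<in> T \<and> \<phi> i = s. c i * h (\<phi> i))"
      using assms by (rule sum.image_gen)
    also have "\<dots> = (\<Sum>s\<in>\<phi> ` T. b s * h s)"
      unfolding b_def sum_distrib_right by (intro sum.cong) auto
    also have "\<dots> = (\<Sum>s\<in>S. b s * h s)"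
      using assms by (intro sum.mono_neutral_right) (auto simp: S_def)
    finally show ?thesis .
  qed
  then show ?thesis
    using assms by (intro exI[of _ S] exI[of _ b]) (auto simp: S_def)
qed

text \<open>
The entries \<open>a\<close> of \<open>A\<close> are encoded as \<open>2 * a\<close> and the entries \<open>i\<close> of \<open>I\<close> as \<open>2 * i + 1\<close>, which makes
them distinct without changing their order; the vector at \<open>e\<close> is \<open>w (e div 2)\<close>. Halving is monotone,
so it carries the bounds over from sets to tuples. A subset that contains both codes of a common
entry yields a tuple with a repetition, and its minor is zero.
\<close>

theorem tuple_straightening:
  assumes A: "A \<in> index_tuples r m" and I: "I \<in> index_tuples n m" and "r \<le> n"
  shows "\<exists>S b. finite S \<and> S \<subseteq> index_tuples r m \<times> index_tuples n m \<and>
    (\<forall>s\<in>S. b s \<noteq> 0 \<and> fst s \<succeq> A \<and> fst s \<succeq> I \<and> A \<succeq> snd s \<and> I \<succeq> snd s) \<and>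
    (\<forall>(w :: nat \<Rightarrow> nat \<Rightarrow> 'a::idom) V. tuple_minor (push n V w) A * tuple_minor w I =
      (\<Sum>s\<in>S. b s * (tuple_minor (push n V w) (fst s) * tuple_minor w (snd s))))"
proof -
  define S0 where "S0 = (\<lambda>a. 2 * a) ` set A"
  define S1 where "S1 = (\<lambda>i. 2 * i + 1) ` set I"
  define E where "E = S0 \<union> S1"
  define half :: "nat list \<Rightarrow> nat list" where "half = map (\<lambda>e. e div 2)"
  have sA: "sorted_wrt (<) A" "length A = r" "set A \<subseteq> {..<m}"
    and sI: "sorted_wrt (<) I" "length I = n" "set I \<subseteq> {..<m}"
    using A I by (auto simp: index_tuples_def)
  have fin: "finite E" "finite S0" "finite S1" by (auto simp: E_def S0_def S1_def)
  have list0: "sorted_list_of_set S0 = map (\<lambda>a. 2 * a) A"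
    using strict_sorted_list_of_set_set[of "map (\<lambda>a. 2 * a) A"] sA by (simp add: S0_def sorted_wrt_map)
  have list1: "sorted_list_of_set S1 = map (\<lambda>i. 2 * i + 1) I"
    using strict_sorted_list_of_set_set[of "map (\<lambda>i. 2 * i + 1) I"] sI by (simp add: S1_def sorted_wrt_map)
  have "S0 \<inter> S1 = {}" unfolding S0_def S1_def by (auto; presburger)
  then have E_S0: "E - S0 = S1" and E_S1: "E - S1 = S0" by (auto simp: E_def)
  have "card S0 = r" "card S1 = n"
    using arg_cong[OF list0, of length] arg_cong[OF list1, of length] sA sI by auto
  then have cardE: "card E = n + r"
    using \<open>S0 \<inter> S1 = {}\<close> fin by (simp add: E_def card_Un_disjoint)
  have half: "half (sorted_list_of_set S0) = A" "half (sorted_list_of_set S1) = I"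
    by (simp_all add: list0 list1 half_def comp_def)
  have half_mono: "half (sorted_list_of_set P) \<succeq> half (sorted_list_of_set P')"
    if "finite P" "finite P'" "dominates P P'" for P P'
    unfolding half_def using that
    by (intro tuple_ge_map) (auto simp: tuple_ge_iff_dominates mono_def div_le_mono)
  define T where "T = {Q. Q \<subseteq> E \<and> card Q = r \<and> dominates Q S0 \<and> dominates Q S1}"
  define T' where "T' = {Q \<in> T. distinct (half (sorted_list_of_set Q)) \<and>
    distinct (half (sorted_list_of_set (E - Q)))}"
  define \<phi> where "\<phi> Q = (half (sorted_list_of_set Q), half (sorted_list_of_set (E - Q)))" for Q
  have "finite T" using fin by (simp add: T_def)
  have index: "half (sorted_list_of_set P) \<in> index_tuples (card P) m"
    if "P \<subseteq> E" "distinct (half (sorted_list_of_set P))" for P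
  proof -
    have "finite P" using that(1) fin(1) finite_subset by blast
    moreover have "e div 2 < m" if "e \<in> E" for e
      using that sA sI by (auto simp: E_def S0_def S1_def)
    moreover have "sorted (half (sorted_list_of_set P))"
      unfolding half_def by (rule sorted_map_mono[OF sorted_sorted_list_of_set]) (auto simp: mono_on_def div_le_mono)
    ultimately show ?thesis using that
      by (auto simp: index_tuples_def strict_sorted_iff) (auto simp: half_def)
  qed
  have bounds: "\<phi> Q \<in> index_tuples r m \<times> index_tuples n m \<and>
      fst (\<phi> Q) \<succeq> A \<and> fst (\<phi> Q) \<succeq> I \<and> A \<succeq> snd (\<phi> Q) \<and> I \<succeq> snd (\<phi> Q)" if "Q \<in> T'" for Q
  proof -
    have Q: "Q \<subseteq> E" "card Q = r" "dominates Q S0" "dominates Q S1"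
      using that by (auto simp: T'_def T_def)
    then have "finite Q" using fin(1) finite_subset by blast
    then have "card (E - Q) = n" using Q cardE by (simp add: card_Diff_subset)
    then have "\<phi> Q \<in> index_tuples r m \<times> index_tuples n m"
      using index[of Q] index[of "E - Q"] that Q by (auto simp: \<phi>_def T'_def)
    moreover have "dominates S1 (E - Q)" "dominates S0 (E - Q)"
      using dominates_complement[OF fin(1) Q(1), of S0] dominates_complement[OF fin(1) Q(1), of S1] Q E_S0 E_S1
      by (auto simp: E_def)
    ultimately show ?thesis
      using half_mono[of Q S0] half_mono[of Q S1] half_mono[of S0 "E - Q"] half_mono[of S1 "E - Q"]
        half fin \<open>finite Q\<close> Q by (simp add: \<phi>_def)
  qed
  obtain c :: "nat set \<Rightarrow> 'a" where
    c: "\<And>w V. minor_product n V w E S0 = (\<Sum>Q\<in>T. c Q * minor_product n V w E Q)"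
    using minor_product_straightening[OF fin(1) cardE assms(3), of S0] \<open>card S0 = r\<close>
    unfolding T_def E_S0 by (auto simp: E_def)
  have expand: "tuple_minor (push n V w) A * tuple_minor w I =
      (\<Sum>Q\<in>T'. c Q * (tuple_minor (push n V w) (fst (\<phi> Q)) * tuple_minor w (snd (\<phi> Q))))"
    for V and w :: "nat \<Rightarrow> nat \<Rightarrow> 'a"
  proof -
    define w' where "w' = (\<lambda>e. w (e div 2))"
    have "push n V w' = (\<lambda>e. push n V w (e div 2))" by (simp add: push_def w'_def fun_eq_iff)
    then have mp: "minor_product n V w' E Q =
        tuple_minor (push n V w) (fst (\<phi> Q)) * tuple_minor w (snd (\<phi> Q))" for Q
      using set_minor_comp[of "push n V w" "\<lambda>e. e div 2" Q] set_minor_comp[of w "\<lambda>e. e div 2" "E - Q"]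
      by (simp add: minor_product_def w'_def \<phi>_def half_def)
    have "tuple_minor (push n V w) A * tuple_minor w I = minor_product n V w' E S0"
      by (simp add: mp \<phi>_def E_S0 half)
    also have "\<dots> = (\<Sum>Q\<in>T. c Q * minor_product n V w' E Q)" by (rule c)
    also have "\<dots> = (\<Sum>Q\<in>T'. c Q * minor_product n V w' E Q)"
      using \<open>finite T\<close>
      by (intro sum.mono_neutral_right) (auto simp: T'_def mp \<phi>_def dest: distinct_if_tuple_minor)
    finally show ?thesis by (simp add: mp)
  qed
  have "finite T'" using \<open>finite T\<close> by (simp add: T'_def)
  from collect_terms[OF this, of \<phi> c] obtain S b where S: "finite S" "S \<subseteq> \<phi> ` T'" "\<forall>s\<in>S. b s \<noteq> 0"
    and sum: "\<And>h. (\<Sum>Q\<in>T'. c Q * h (\<phi> Q)) = (\<Sum>s\<in>S. b s * h s)" by blast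
  have "\<forall>s\<in>S. s \<in> index_tuples r m \<times> index_tuples n m \<and>
      fst s \<succeq> A \<and> fst s \<succeq> I \<and> A \<succeq> snd s \<and> I \<succeq> snd s"
    using bounds S(2) by blast
  then show ?thesis
    using S sum[of "\<lambda>s. tuple_minor (push n _ _) (fst s) * tuple_minor _ (snd s)"]
    by (intro exI[of _ S] exI[of _ b]) (auto simp: expand sum[of "\<lambda>s. tuple_minor (push n _ _) (fst s) * tuple_minor _ (snd s)"])
qed

corollary tuple_straightening_equal_length:
  assumes I: "I \<in> index_tuples n m" and I': "I' \<in> index_tuples n m"
  shows "\<exists>S b. finite S \<and> S \<subseteq> index_tuples n m \<times> index_tuples n m \<and>
    (\<forall>s\<in>S. b s \<noteq> 0 \<and> fst s \<succeq> I \<and> fst s \<succeq> I' \<and> I \<succeq> snd s \<and> I' \<succeq> snd s) \<and>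
    (\<forall>w :: nat \<Rightarrow> nat \<Rightarrow> 'a::idom. tuple_minor w I * tuple_minor w I' =
      (\<Sum>s\<in>S. b s * (tuple_minor w (fst s) * tuple_minor w (snd s))))"
proof -
  define V :: "nat \<Rightarrow> nat \<Rightarrow> 'a" where "V l j = (if l = j then 1 else 0)" for l j
  have "push n V w i j = w i j" if "j < n" for w i j
    using that by (simp add: push_def V_def if_distrib[of "\<lambda>x. _ * x"] cong: if_cong)
  then have V: "tuple_minor (push n V w) P = tuple_minor w P" if "P \<in> index_tuples n m" for w P
    using that by (intro tuple_minor_cong) (auto simp: index_tuples_def)
  from tuple_straightening[OF I I' order_refl, where ?'a = 'a]
  obtain S and b :: "nat list \<times> nat list \<Rightarrow> 'a" where S: "finite S" "S \<subseteq> index_tuples n m \<times> index_tuples n m"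
    "\<forall>s\<in>S. b s \<noteq> 0 \<and> fst s \<succeq> I \<and> fst s \<succeq> I' \<and> I \<succeq> snd s \<and> I' \<succeq> snd s"
    "\<And>w V. tuple_minor (push n V w) I * tuple_minor w I' =
      (\<Sum>s\<in>S. b s * (tuple_minor (push n V w) (fst s) * tuple_minor w (snd s)))"
    by blast
  have "tuple_minor w I * tuple_minor w I' =
      (\<Sum>s\<in>S. b s * (tuple_minor w (fst s) * tuple_minor w (snd s)))" for w
  proof -
    have "tuple_minor w I * tuple_minor w I' = (\<Sum>s\<in>S. b s * (tuple_minor (push n V w) (fst s) * tuple_minor w (snd s)))"
      using S(4)[of V w] V[OF I] by simp
    also have "\<dots> = (\<Sum>s\<in>S. b s * (tuple_minor w (fst s) * tuple_minor w (snd s)))"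
      using S(2) V by (intro sum.cong) auto
    finally show ?thesis .
  qed
  then show ?thesis using S(1-3) by blast
qed

section \<open>Minors of arbitrary size as maximal minors\<close>

definition block_minor :: "(nat \<Rightarrow> nat \<Rightarrow> 'a::comm_ring_1) \<Rightarrow> nat list \<Rightarrow> nat list \<Rightarrow> 'a" where
  "block_minor Z A B = det (mat (length A) (length B) (\<lambda>(i, j). Z (A ! i) (B ! j)))"

text \<open>
The matrix \<open>Z\<close> with \<open>m\<close> rows and \<open>q\<close> columns on top of the reversed identity matrix: row \<open>m + i\<close> is the
unit vector with index \<open>q - 1 - i\<close>. With this order of the unit vectors the order on tuples of rows
corresponds to the order on pairs, see \<open>parts_mono\<close>.
\<close>

definition adjoin_identity :: "nat \<Rightarrow> nat \<Rightarrow> (nat \<Rightarrow> nat \<Rightarrow> 'a::comm_ring_1) \<Rightarrow> nat \<Rightarrow> nat \<Rightarrow> 'a" where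
  "adjoin_identity m q Z i j = (if i < m then Z i j else if i + j + 1 = m + q then 1 else 0)"

text \<open>
A choice \<open>T\<close> of \<open>q\<close> rows of the enlarged matrix encodes a minor of \<open>Z\<close>: its rows are the rows of \<open>Z\<close>
in \<open>T\<close>, and its columns are those \<open>b\<close> whose unit vector, in row \<open>m + q - 1 - b\<close>, is not in \<open>T\<close>.
\<close>

definition row_part :: "nat \<Rightarrow> nat list \<Rightarrow> nat list" where
  "row_part m T = sorted_list_of_set {i \<in> set T. i < m}"

definition column_part :: "nat \<Rightarrow> nat \<Rightarrow> nat list \<Rightarrow> nat list" where
  "column_part m q T = sorted_list_of_set {b. b < q \<and> m + q - 1 - b \<notin> set T}"

lemma index_tuples_parts:
  assumes T: "T \<in> index_tuples q (m + q)"
  shows "row_part m T \<in> index_tuples (length (row_part m T)) m"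
    and "column_part m q T \<in> index_tuples (length (row_part m T)) q"
    and "set (row_part m T) = {i \<in> set T. i < m}"
    and "set (column_part m q T) = {b. b < q \<and> m + q - 1 - b \<notin> set T}"
proof -
  define A where "A = {i \<in> set T. i < m}"
  define B where "B = {b. b < q \<and> m + q - 1 - b \<notin> set T}"
  define B' where "B' = {b. b < q \<and> m + q - 1 - b \<in> set T}"
  have T': "length T = q" "distinct T" "set T \<subseteq> {..<m + q}"
    using T by (auto simp: index_tuples_def strict_sorted_iff)
  have fin: "finite A" "finite B" "finite B'" by (auto simp: A_def B_def B'_def)
  have "bij_betw (\<lambda>i. m + q - 1 - i) {i \<in> set T. m \<le> i} B'"
    by (rule bij_betw_byWitness[where f' = "\<lambda>b. m + q - 1 - b"]) (use T' in \<open>auto simp: B'_def\<close>)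
  then have "card {i \<in> set T. m \<le> i} = card B'" by (rule bij_betw_same_card)
  moreover have "card (set T) = card A + card {i \<in> set T. m \<le> i}"
    unfolding A_def by (subst card_Un_disjoint[symmetric]) (auto intro: arg_cong[of _ _ card])
  moreover have "q = card B + card B'"
  proof -
    have "B \<union> B' = {..<q}" by (auto simp: B_def B'_def)
    then have "card (B \<union> B') = q" by simp
    then show ?thesis using fin by (subst (asm) card_Un_disjoint) (auto simp: B_def B'_def)
  qed
  ultimately have "card A = card B" using T' by (simp add: distinct_card)
  then show "row_part m T \<in> index_tuples (length (row_part m T)) m"
    "column_part m q T \<in> index_tuples (length (row_part m T)) q"
    "set (row_part m T) = {i \<in> set T. i < m}"
    "set (column_part m q T) = {b. b < q \<and> m + q - 1 - b \<notin> set T}"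
    using fin by (auto simp: index_tuples_def row_part_def column_part_def A_def B_def)
qed

text \<open>
If the columns in \<open>B\<close> are moved to the front and the others are arranged in the order in which their
unit vectors occur in \<open>T\<close>, the matrix becomes block upper triangular with diagonal blocks the
submatrix of \<open>Z\<close> and an identity matrix.
\<close>

lemma tuple_minor_adjoin_identity:
  assumes T: "T \<in> index_tuples q (m + q)"
  shows "\<exists>\<epsilon> :: 'a::idom. \<epsilon> * \<epsilon> = 1 \<and>
    (\<forall>Z. tuple_minor (adjoin_identity m q Z) T = \<epsilon> * block_minor Z (row_part m T) (column_part m q T))"
proof -
  define A where "A = row_part m T"
  define B where "B = column_part m q T"
  define C where "C = sorted_list_of_set {i \<in> set T. m \<le> i}"
  \<comment> \<open>the columns of the minor first, then each remaining column in the order of its unit vector\<close>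
  define K where "K = B @ map (\<lambda>i. m + q - 1 - i) C"
  define r where "r = length A"
  note parts = index_tuples_parts[OF T, folded A_def B_def]
  have T': "length T = q" "sorted_wrt (<) T" "set T \<subseteq> {..<m + q}"
    using T by (auto simp: index_tuples_def)
  have lenB: "length B = r" and dist: "distinct A" "distinct B" "sorted_wrt (<) A"
    using parts(1,2) by (auto simp: index_tuples_def r_def strict_sorted_iff)
  have C: "set C = {i \<in> set T. m \<le> i}" "sorted_wrt (<) C" "distinct C" by (simp_all add: C_def)
  have "sorted_wrt (<) (A @ C)" using dist C parts(3) by (auto simp: sorted_wrt_append)
  moreover have "set (A @ C) = set T" using parts(3) C by auto
  ultimately have TAC: "T = A @ C" using T'(2) by (metis strict_sorted_equal)
  then have q: "q = r + length C" using T' by (simp add: r_def)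
  have "mset K = mset [0..<q]"
  proof -
    have "inj_on (\<lambda>i. m + q - 1 - i) (set C)"
    proof (rule inj_onI)
      fix i j assume "i \<in> set C" "j \<in> set C" "m + q - 1 - i = m + q - 1 - j"
      moreover from this have "i < m + q" "j < m + q" using C(1) T'(3) by auto
      ultimately show "i = j" by linarith
    qed
    moreover have "m + q - 1 - i \<notin> set B" if "i \<in> set C" for i
    proof -
      have "i \<in> set T" "i < m + q" using that C(1) T'(3) by auto
      moreover from this have "m + q - 1 - (m + q - 1 - i) = i" by simp
      ultimately show ?thesis using parts(4) by auto
    qed
    ultimately have "distinct K" using dist C(3) by (auto simp: K_def distinct_map)
    moreover have "set K = set [0..<q]"
    proof -
      have "b \<in> (\<lambda>i. m + q - 1 - i) ` set C" if "b < q" "b \<notin> set B" for b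
        using that C(1) parts(4) by (intro image_eqI[of _ _ "m + q - 1 - b"]) auto
      then show ?thesis using C(1) T' parts(4) by (auto simp: K_def)
    qed
    ultimately show ?thesis using set_eq_iff_mset_eq_distinct distinct_upt by blast
  qed
  then obtain \<sigma> where "\<sigma> permutes {0..<length [0..<q]}"
    and K\<sigma>': "\<And>i. i < length [0..<q] \<Longrightarrow> K ! i = [0..<q] ! \<sigma> i"
    using permutation_of_mset_eq by metis
  then have \<sigma>: "\<sigma> permutes {0..<q}" by simp
  then have \<sigma>_lt: "\<sigma> i < q" if "i < q" for i
    using that by (metis atLeastLessThan_iff le0 permutes_in_image)
  have K\<sigma>: "\<sigma> i = K ! i" if "i < q" for i using K\<sigma>'[of i] \<sigma>_lt[OF that] that by simp
  have \<sigma>B: "\<sigma> j = B ! j" if "j < r" for j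
    using that K\<sigma>[of j] lenB q by (simp add: K_def nth_append)
  have \<sigma>C: "\<sigma> j = m + q - 1 - C ! (j - r)" if "r \<le> j" "j < q" for j
    using that K\<sigma>[of j] lenB q by (simp add: K_def nth_append)
  have Cmem: "C ! i \<in> set T" "m \<le> C ! i" "C ! i < m + q" if "i < length C" for i
    using nth_mem[OF that] C(1) T'(3) by auto
  have "tuple_minor (adjoin_identity m q Z) T = signof \<sigma> * block_minor Z A B" for Z :: "nat \<Rightarrow> nat \<Rightarrow> 'a"
  proof -
    define f where "f i j = adjoin_identity m q Z (T ! i) j" for i j
    let ?F = "four_block_mat (mat r r (\<lambda>(i, j). Z (A ! i) (B ! j)))
      (mat r (length C) (\<lambda>(i, j). f i (\<sigma> (r + j)))) (0\<^sub>m (length C) r) (1\<^sub>m (length C))"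
    have "mat q q (\<lambda>(i, j). f i (\<sigma> j)) = ?F"
    proof (rule eq_matI)
      fix i j assume "i < dim_row ?F" "j < dim_col ?F"
      then have ij: "i < q" "j < q" by (auto simp: q)
      show "mat q q (\<lambda>(i, j). f i (\<sigma> j)) $$ (i, j) = ?F $$ (i, j)"
      proof (cases "i < r")
        case True
        then have "A ! i \<in> set A" by (simp add: r_def)
        then have "A ! i < m" unfolding parts(3) by simp
        moreover have "T ! i = A ! i" using True by (simp add: TAC nth_append r_def)
        ultimately show ?thesis using ij True \<sigma>B by (auto simp: f_def adjoin_identity_def q)
      next
        case False
        then have Ti: "T ! i = C ! (i - r)" and iC: "i - r < length C"
          using ij by (auto simp: TAC nth_append r_def q)
        have "T ! i + \<sigma> j + 1 = m + q \<longleftrightarrow> i = j"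
        proof (cases "j < r")
          case True
          then have "B ! j \<in> set B" using lenB by simp
          then have "B ! j < q" "m + q - 1 - B ! j \<notin> set T" using parts(4) by auto
          moreover have "m + q - 1 - B ! j = T ! i" if "T ! i + B ! j + 1 = m + q"
            using that by linarith
          ultimately have "T ! i + B ! j + 1 \<noteq> m + q" using Cmem(1)[OF iC] Ti by auto
          then show ?thesis using True False \<sigma>B by auto
        next
          case j: False
          then have jC: "j - r < length C" using ij q by simp
          have "T ! i + \<sigma> j + 1 = m + q \<longleftrightarrow> C ! (i - r) = C ! (j - r)"
            unfolding Ti \<sigma>C[OF leI[OF j] ij(2)] using Cmem(3)[OF jC] by linarith
          also have "\<dots> \<longleftrightarrow> i = j"
            using C(3) iC jC j False by (simp add: nth_eq_iff_index_eq) linarith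
          finally show ?thesis .
        qed
        then show ?thesis using ij False Ti Cmem[OF iC] by (auto simp: f_def adjoin_identity_def q)
      qed
    qed (auto simp: q)
    then have "det (mat q q (\<lambda>(i, j). f i (\<sigma> j))) = block_minor Z A B"
      by (simp add: det_four_block_mat_lower_left_zero[where n = r and m = "length C"]
          block_minor_def lenB r_def[symmetric])
    then have "signof \<sigma> * tuple_minor (adjoin_identity m q Z) T = block_minor Z A B"
      using det_permute_columns[OF \<sigma>, of f] T'(1) by (simp add: tuple_minor_def f_def)
    then show ?thesis using signof_square[of \<sigma>, where ?'a = 'a] by (metis mult.assoc mult_1)
  qed
  then show ?thesis unfolding A_def B_def
    by (intro exI[of _ "signof \<sigma>"] conjI signof_square allI)
qed

text \<open>
The counting function of \<open>T\<close> up to \<open>m\<close> is that of its row part. Beyond \<open>m\<close> it determines that of the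
column part, because counting unit vectors from the top means counting missing columns from the
right.
\<close>

lemma card_below_parts:
  assumes T: "T \<in> index_tuples q (m + q)"
  shows "card (set (row_part m T) \<inter> {..<t}) = card (set T \<inter> {..<min t m})"
    and "card (set (column_part m q T) \<inter> {..<t}) + (q - min t q) = card (set T \<inter> {..<m + (q - min t q)})"
proof -
  note parts = index_tuples_parts[OF T]
  have T': "length T = q" "distinct T" "set T \<subseteq> {..<m + q}"
    using T by (auto simp: index_tuples_def strict_sorted_iff)
  show "card (set (row_part m T) \<inter> {..<t}) = card (set T \<inter> {..<min t m})"
    unfolding parts by (rule arg_cong[of _ _ card]) auto
  define s where "s = min t q"
  define B where "B = {b. b < s \<and> m + q - 1 - b \<notin> set T}"
  define B' where "B' = {b. b < s \<and> m + q - 1 - b \<in> set T}"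
  have sq: "s \<le> q" by (simp add: s_def)
  have "bij_betw (\<lambda>i. m + q - 1 - i) {i \<in> set T. m + (q - s) \<le> i} B'"
    by (rule bij_betw_byWitness[where f' = "\<lambda>b. m + q - 1 - b"]) (use T' sq in \<open>auto simp: B'_def\<close>)
  then have "card {i \<in> set T. m + (q - s) \<le> i} = card B'" by (rule bij_betw_same_card)
  moreover have "card (set T) = card (set T \<inter> {..<m + (q - s)}) + card {i \<in> set T. m + (q - s) \<le> i}"
    by (subst card_Un_disjoint[symmetric]) (auto intro: arg_cong[of _ _ card])
  moreover have "s = card B + card B'"
  proof -
    have "B \<union> B' = {..<s}" by (auto simp: B_def B'_def)
    then have "card (B \<union> B') = s" by simp
    moreover have "finite B" "finite B'" by (auto simp: B_def B'_def)
    ultimately show ?thesis by (subst (asm) card_Un_disjoint) (auto simp: B_def B'_def)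
  qed
  moreover have "set (column_part m q T) \<inter> {..<t} = B"
    unfolding parts by (auto simp: B_def s_def)
  ultimately show "card (set (column_part m q T) \<inter> {..<t}) + (q - min t q) = card (set T \<inter> {..<m + (q - min t q)})"
    using T' sq by (simp add: distinct_card s_def[symmetric])
qed

lemma parts_mono:
  assumes "T \<in> index_tuples q (m + q)" and "T' \<in> index_tuples q (m + q)" and "T \<succeq> T'"
  shows "row_part m T \<succeq> row_part m T'" and "column_part m q T \<succeq> column_part m q T'"
proof -
  have d: "card (set T \<inter> {..<t}) \<le> card (set T' \<inter> {..<t})" for t
    using assms by (simp add: tuple_ge_iff_dominates sorted_wrt_index_tuples dominates_def)
  have sorted: "sorted_wrt (<) (row_part m R)" "sorted_wrt (<) (column_part m q R)" for R
    by (simp_all add: row_part_def column_part_def)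
  have "dominates (set (row_part m T)) (set (row_part m T'))"
    unfolding dominates_def by (simp only: card_below_parts[OF assms(1)] card_below_parts[OF assms(2)] d simp_thms)
  then show "row_part m T \<succeq> row_part m T'" by (simp add: tuple_ge_iff_dominates sorted)
  have "dominates (set (column_part m q T)) (set (column_part m q T'))"
    unfolding dominates_def
    by (metis add_le_cancel_right card_below_parts(2)[OF assms(1)] card_below_parts(2)[OF assms(2)] d)
  then show "column_part m q T \<succeq> column_part m q T'" by (simp add: tuple_ge_iff_dominates sorted)
qed

lemma parts_surj:
  assumes A: "A \<in> index_tuples r m" and B: "B \<in> index_tuples r q"
  obtains T where "T \<in> index_tuples q (m + q)" and "row_part m T = A" and "column_part m q T = B"
proof
  define R where "R = {i. m \<le> i \<and> i < m + q \<and> m + q - 1 - i \<notin> set B}"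
  define T where "T = sorted_list_of_set (set A \<union> R)"
  have A': "sorted_wrt (<) A" "set A \<subseteq> {..<m}" "card (set A) = r"
    and B': "sorted_wrt (<) B" "set B \<subseteq> {..<q}" "card (set B) = r"
    using A B by (auto simp: index_tuples_def strict_sorted_iff distinct_card)
  have finR: "finite R" by (simp add: R_def)
  have setT: "set T = set A \<union> R" using finR by (simp add: T_def)
  have "bij_betw (\<lambda>i. m + q - 1 - i) R ({..<q} - set B)"
    by (rule bij_betw_byWitness[where f' = "\<lambda>b. m + q - 1 - b"]) (auto simp: R_def)
  from bij_betw_same_card[OF this] have "card R = q - r"
    using B' by (simp add: card_Diff_subset)
  moreover have "r \<le> q" using B' card_mono[of "{..<q}" "set B"] by simp
  ultimately have "card (set A \<union> R) = q"
    using A' finR by (subst card_Un_disjoint) (auto simp: R_def)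
  then show "T \<in> index_tuples q (m + q)"
    using A' finR by (auto simp: index_tuples_def T_def R_def)
  have "{i \<in> set T. i < m} = set A" unfolding setT using A' by (auto simp: R_def)
  then show "row_part m T = A" using A' by (simp add: row_part_def strict_sorted_list_of_set_set)
  have "{b. b < q \<and> m + q - 1 - b \<notin> set T} = set B"
  proof -
    have "m + q - 1 - b \<notin> set A" "m + q - 1 - (m + q - 1 - b) = b" if "b < q" for b
      using that A'(2) by auto
    then show ?thesis unfolding setT using B' by (auto simp: R_def)
  qed
  then show "column_part m q T = B" using B' by (simp add: column_part_def strict_sorted_list_of_set_set)
qed

text \<open>
Both factors are padded with zeros to square matrices of the size of the minor.
\<close>

lemma block_minor_eq_0:
  assumes "length A = length B" and "n < length A"
  shows "block_minor (\<lambda>i j. \<Sum>l<n. y i l * z l j) A B = (0 :: 'a::comm_ring_1)"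
proof -
  define k where "k = length A"
  define M where "M = mat k k (\<lambda>(i, l). if l < n then y (A ! i) l else 0)"
  define M' where "M' = mat k k (\<lambda>(l, j). z l (B ! j))"
  have "det M = 0" unfolding M_def by (rule det_zero_column[of n]) (use assms in \<open>auto simp: k_def\<close>)
  moreover have "mat k k (\<lambda>(i, j). \<Sum>l<n. y (A ! i) l * z l (B ! j)) = M * M'"
  proof (rule eq_matI)
    fix i j assume "i < dim_row (M * M')" "j < dim_col (M * M')"
    then have ij: "i < k" "j < k" by (auto simp: M_def M'_def)
    then have "(M * M') $$ (i, j) = (\<Sum>l=0..<k. if l < n then y (A ! i) l * z l (B ! j) else 0)"
      by (auto simp: M_def M'_def scalar_prod_def intro!: sum.cong)
    also have "\<dots> = (\<Sum>l<n. y (A ! i) l * z l (B ! j))"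
      using assms by (intro sum.mono_neutral_cong_right) (auto simp: k_def)
    finally show "mat k k (\<lambda>(i, j). \<Sum>l<n. y (A ! i) l * z l (B ! j)) $$ (i, j) = (M * M') $$ (i, j)"
      using ij by simp
  qed (auto simp: M_def M'_def)
  moreover have "det (M * M') = det M * det M'" by (rule det_mult[of _ k]) (auto simp: M_def M'_def)
  ultimately show ?thesis using assms by (simp add: block_minor_def k_def)
qed

text \<open>
Both minors are written as maximal minors of the enlarged matrix, and the straightening of
these is translated back. The empty pair \<open>([], [])\<close>, with minor 1, corresponds to the choice of all
rows of the identity matrix.
\<close>

theorem block_minor_straightening:
  assumes A1: "A1 \<in> index_tuples r m" and A2: "A2 \<in> index_tuples r q"
    and B1: "B1 \<in> index_tuples k m" and B2: "B2 \<in> index_tuples k q"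
  shows "\<exists>S (a :: (nat list \<times> nat list) \<times> (nat list \<times> nat list) \<Rightarrow> 'a::idom). finite S \<and>
    (\<forall>((C1, C2), (D1, D2))\<in>S. a ((C1, C2), (D1, D2)) \<noteq> 0 \<and>
       C1 \<in> index_tuples (length C1) m \<and> C2 \<in> index_tuples (length C1) q \<and>
       D1 \<in> index_tuples (length D1) m \<and> D2 \<in> index_tuples (length D1) q \<and>
       C1 \<succeq> A1 \<and> C1 \<succeq> B1 \<and> A1 \<succeq> D1 \<and> B1 \<succeq> D1 \<and>
       C2 \<succeq> A2 \<and> C2 \<succeq> B2 \<and> A2 \<succeq> D2 \<and> B2 \<succeq> D2) \<and>
    (\<forall>Z. block_minor Z A1 A2 * block_minor Z B1 B2 =
       (\<Sum>((C1, C2), (D1, D2))\<in>S. a ((C1, C2), (D1, D2)) * (block_minor Z C1 C2 * block_minor Z D1 D2)))"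
proof -
  obtain T where T: "T \<in> index_tuples q (m + q)" "row_part m T = A1" "column_part m q T = A2"
    using parts_surj[OF A1 A2] .
  obtain T' where T': "T' \<in> index_tuples q (m + q)" "row_part m T' = B1" "column_part m q T' = B2"
    using parts_surj[OF B1 B2] .
  have "\<forall>P. \<exists>e :: 'a. P \<in> index_tuples q (m + q) \<longrightarrow> e * e = 1 \<and>
      (\<forall>Z. tuple_minor (adjoin_identity m q Z) P = e * block_minor Z (row_part m P) (column_part m q P))"
    using tuple_minor_adjoin_identity by blast
  from choice[OF this] obtain \<epsilon> :: "nat list \<Rightarrow> 'a" where
    \<epsilon>: "\<And>P. P \<in> index_tuples q (m + q) \<Longrightarrow> \<epsilon> P * \<epsilon> P = 1"
    and minor: "\<And>P Z. P \<in> index_tuples q (m + q) \<Longrightarrow>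
      tuple_minor (adjoin_identity m q Z) P = \<epsilon> P * block_minor Z (row_part m P) (column_part m q P)"
    by blast
  from tuple_straightening_equal_length[OF T(1) T'(1), where ?'a = 'a]
  obtain R and b :: "nat list \<times> nat list \<Rightarrow> 'a" where R: "finite R"
      "R \<subseteq> index_tuples q (m + q) \<times> index_tuples q (m + q)"
    and Rge: "\<forall>s\<in>R. b s \<noteq> 0 \<and> fst s \<succeq> T \<and> fst s \<succeq> T' \<and> T \<succeq> snd s \<and> T' \<succeq> snd s"
    and sumR: "\<forall>w. tuple_minor w T * tuple_minor w T' =
      (\<Sum>s\<in>R. b s * (tuple_minor w (fst s) * tuple_minor w (snd s)))" by blast
  define part where "part P = (row_part m P, column_part m q P)" for P
  define c where "c s = \<epsilon> T * \<epsilon> T' * (b s * (\<epsilon> (fst s) * \<epsilon> (snd s)))" for s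
  have expand: "block_minor Z A1 A2 * block_minor Z B1 B2 = (\<Sum>s\<in>R. c s *
      (\<lambda>((C1, C2), (D1, D2)). block_minor Z C1 C2 * block_minor Z D1 D2) (part (fst s), part (snd s)))"
    for Z
  proof -
    have inv: "block_minor Z (row_part m P) (column_part m q P) = \<epsilon> P * tuple_minor (adjoin_identity m q Z) P"
      if "P \<in> index_tuples q (m + q)" for P
      using minor[OF that] \<epsilon>[OF that] by (metis mult.assoc mult_1)
    have "block_minor Z A1 A2 * block_minor Z B1 B2 = \<epsilon> T * \<epsilon> T' *
        (tuple_minor (adjoin_identity m q Z) T * tuple_minor (adjoin_identity m q Z) T')"
      using inv[OF T(1)] inv[OF T'(1)] T T' by (simp add: mult_ac)
    also have "\<dots> = (\<Sum>s\<in>R. \<epsilon> T * \<epsilon> T' * (b s *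
        (tuple_minor (adjoin_identity m q Z) (fst s) * tuple_minor (adjoin_identity m q Z) (snd s))))"
      by (simp only: sumR sum_distrib_left)
    also have "\<dots> = (\<Sum>s\<in>R. c s *
      (\<lambda>((C1, C2), (D1, D2)). block_minor Z C1 C2 * block_minor Z D1 D2) (part (fst s), part (snd s)))"
    proof (rule sum.cong[OF refl])
      fix s assume "s \<in> R"
      then have "fst s \<in> index_tuples q (m + q)" "snd s \<in> index_tuples q (m + q)" using R(2) by auto
      then show "\<epsilon> T * \<epsilon> T' * (b s *
          (tuple_minor (adjoin_identity m q Z) (fst s) * tuple_minor (adjoin_identity m q Z) (snd s))) = c s *
        (\<lambda>((C1, C2), (D1, D2)). block_minor Z C1 C2 * block_minor Z D1 D2) (part (fst s), part (snd s))"
        by (simp add: minor c_def part_def mult_ac)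
    qed
    finally show ?thesis .
  qed
  from collect_terms[OF R(1), of "\<lambda>s. (part (fst s), part (snd s))" c]
  obtain S a where S: "finite S" "S \<subseteq> (\<lambda>s. (part (fst s), part (snd s))) ` R" "\<forall>s\<in>S. a s \<noteq> 0"
    and sumS: "\<And>h. (\<Sum>s\<in>R. c s * h (part (fst s), part (snd s))) = (\<Sum>s\<in>S. a s * h s)" by blast
  have "\<forall>((C1, C2), (D1, D2))\<in>S. a ((C1, C2), (D1, D2)) \<noteq> 0 \<and>
       C1 \<in> index_tuples (length C1) m \<and> C2 \<in> index_tuples (length C1) q \<and>
       D1 \<in> index_tuples (length D1) m \<and> D2 \<in> index_tuples (length D1) q \<and>
       C1 \<succeq> A1 \<and> C1 \<succeq> B1 \<and> A1 \<succeq> D1 \<and> B1 \<succeq> D1 \<and>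
       C2 \<succeq> A2 \<and> C2 \<succeq> B2 \<and> A2 \<succeq> D2 \<and> B2 \<succeq> D2"
  proof (rule ballI)
    fix x assume x: "x \<in> S"
    then obtain s where s: "s \<in> R" "x = (part (fst s), part (snd s))" using S(2) by blast
    then have idx: "fst s \<in> index_tuples q (m + q)" "snd s \<in> index_tuples q (m + q)" using R(2) by auto
    have ge: "fst s \<succeq> T" "fst s \<succeq> T'" "T \<succeq> snd s" "T' \<succeq> snd s" using Rge s(1) by auto
    show "(\<lambda>((C1, C2), (D1, D2)). a ((C1, C2), (D1, D2)) \<noteq> 0 \<and>
       C1 \<in> index_tuples (length C1) m \<and> C2 \<in> index_tuples (length C1) q \<and>
       D1 \<in> index_tuples (length D1) m \<and> D2 \<in> index_tuples (length D1) q \<and>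
       C1 \<succeq> A1 \<and> C1 \<succeq> B1 \<and> A1 \<succeq> D1 \<and> B1 \<succeq> D1 \<and>
       C2 \<succeq> A2 \<and> C2 \<succeq> B2 \<and> A2 \<succeq> D2 \<and> B2 \<succeq> D2) x"
      using parts_mono[OF idx(1) T(1) ge(1)] parts_mono[OF idx(1) T'(1) ge(2)]
        parts_mono[OF T(1) idx(2) ge(3)] parts_mono[OF T'(1) idx(2) ge(4)]
        index_tuples_parts(1,2)[OF idx(1)] index_tuples_parts(1,2)[OF idx(2)] T T' S(3) x
      unfolding s(2) part_def by simp
  qed
  moreover have "\<forall>Z. block_minor Z A1 A2 * block_minor Z B1 B2 =
       (\<Sum>((C1, C2), (D1, D2))\<in>S. a ((C1, C2), (D1, D2)) * (block_minor Z C1 C2 * block_minor Z D1 D2))"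
    unfolding expand sumS by (auto intro!: sum.cong)
  ultimately show ?thesis using S(1) by blast
qed

section \<open>The functions on pairs of matrices\<close>

lemma pairing_eq_sum:
  assumes "x \<in> point_space n m q" and "i < m" and "j < q"
  shows "pairing x i j = (\<Sum>l<n. fst x $$ (i, l) * snd x $$ (l, j))"
  using assms by (auto simp: pairing_def point_space_def scalar_prod_def lessThan_atLeast0 intro!: sum.cong)

lemma u_eq_tuple_minor: "I \<in> index_tuples n m \<Longrightarrow> u n I x = tuple_minor (\<lambda>i j. fst x $$ (i, j)) I"
  by (simp add: u_def tuple_minor_def index_tuples_def)

lemma xi_eq_tuple_minor:
  assumes "J \<in> index_tuples n q"
  shows "\<xi> n J x = tuple_minor (\<lambda>j i. snd x $$ (i, j)) J"
proof -
  have "mat n n (\<lambda>(j, i). snd x $$ (i, J ! j)) = transpose_mat (mat n n (\<lambda>(i, j). snd x $$ (i, J ! j)))"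
    by (rule eq_matI) auto
  then show ?thesis
    using assms det_transpose[of "mat n n (\<lambda>(i, j). snd x $$ (i, J ! j))" n]
    by (simp add: xi_def tuple_minor_def index_tuples_def)
qed

lemma index_tuples_nth_less:
  assumes "A \<in> index_tuples r k" and "i < r"
  shows "A ! i < k"
proof -
  have "length A = r" "set A \<subseteq> {..<k}" using assms(1) by (auto simp: index_tuples_def)
  moreover from this have "A ! i \<in> set A" using assms(2) by simp
  ultimately show ?thesis by auto
qed

text \<open>
The function \<open>p\<close> is a minor of the vectors \<open>u\<^sub>i\<close>, mapped to \<open>K\<^sup>r\<close> by the covectors with index in \<open>B\<close>;
symmetrically, it is a minor of the covectors, mapped by the vectors with index in \<open>A\<close>.
\<close>

lemma p_eq_row_minor:
  assumes "x \<in> point_space n m q" and "A \<in> index_tuples r m" and "B \<in> index_tuples r q"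
  shows "p A B x = tuple_minor (push n (\<lambda>l j. snd x $$ (l, B ! j)) (\<lambda>i j. fst x $$ (i, j))) A"
proof -
  have "length A = r" "length B = r" using assms by (auto simp: index_tuples_def)
  then show ?thesis unfolding p_def tuple_minor_def push_def
    using assms by (intro arg_cong[of _ _ det] eq_matI) (auto simp: pairing_eq_sum[of x n m q] index_tuples_nth_less)
qed

lemma p_eq_column_minor:
  assumes "x \<in> point_space n m q" and "A \<in> index_tuples r m" and "B \<in> index_tuples r q"
  shows "p A B x = tuple_minor (push n (\<lambda>l i. fst x $$ (A ! i, l)) (\<lambda>j i. snd x $$ (i, j))) B"
proof -
  have len: "length A = r" "length B = r" using assms by (auto simp: index_tuples_def)
  define M where "M = mat r r (\<lambda>(i, j). pairing x (A ! i) (B ! j))"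
  have "p A B x = det (transpose_mat M)"
    using len det_transpose[of M r] by (simp add: p_def M_def)
  also have "transpose_mat M =
      mat r r (\<lambda>(j, i). push n (\<lambda>l i. fst x $$ (A ! i, l)) (\<lambda>j i. snd x $$ (i, j)) (B ! j) i)"
    using assms by (intro eq_matI)
      (auto simp: M_def push_def pairing_eq_sum[of x n m q] index_tuples_nth_less mult.commute)
  finally show ?thesis using len by (simp add: tuple_minor_def)
qed

lemma p_eq_block_minor: "p A B x = block_minor (pairing x) A B"
  by (simp add: p_def block_minor_def)

lemma p_eq_0:
  assumes "x \<in> point_space n m q" and "A \<in> index_tuples r m" and "B \<in> index_tuples r q" and "n < r"
  shows "p A B x = 0"
proof -
  have len: "length A = r" "length B = r" using assms by (auto simp: index_tuples_def)
  have "p A B x = block_minor (\<lambda>i j. \<Sum>l<n. fst x $$ (i, l) * snd x $$ (l, j)) A B"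
    unfolding p_def block_minor_def using assms len
    by (intro arg_cong[of _ _ det] eq_matI) (auto simp: pairing_eq_sum[of x n m q] index_tuples_nth_less)
  then show ?thesis using len assms(4)
    block_minor_eq_0[of A B n "\<lambda>i l. fst x $$ (i, l)" "\<lambda>l j. snd x $$ (l, j)"] by simp
qed

lemma u_times_xi:
  assumes "I \<in> H_u n m" and "J \<in> H_xi n q" and "x \<in> point_space n m q"
  shows "u n I x * \<xi> n J x = p I J x"
proof -
  define M where "M = mat n n (\<lambda>(i, j). fst x $$ (I ! i, j))"
  define M' where "M' = mat n n (\<lambda>(i, j). snd x $$ (i, J ! j))"
  have I: "I \<in> index_tuples n m" and J: "J \<in> index_tuples n q" using assms by (auto simp: H_u_def H_xi_def)
  then have len: "length I = n" "length J = n" by (auto simp: index_tuples_def)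
  have "mat n n (\<lambda>(i, j). pairing x (I ! i) (J ! j)) = M * M'"
    using assms(3) I J by (intro eq_matI)
      (auto simp: M_def M'_def scalar_prod_def pairing_eq_sum[of x n m q] index_tuples_nth_less lessThan_atLeast0)
  moreover have "det (M * M') = det M * det M'" by (rule det_mult[of _ n]) (auto simp: M_def M'_def)
  ultimately show ?thesis by (simp add: p_def u_def xi_def len M_def M'_def)
qed

lemma u_straightening:
  assumes "I \<in> H_u n m" and "I' \<in> H_u n m"
  shows "\<exists>S (b :: nat list \<Rightarrow> nat list \<Rightarrow> 'k::idom). finite S \<and> S \<subseteq> H_u n m \<times> H_u n m \<and>
    (\<forall>(P, P')\<in>S. b P P' \<noteq> 0 \<and> P \<succeq> I \<and> P \<succeq> I' \<and> I \<succeq> P' \<and> I' \<succeq> P') \<and>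
    (\<forall>x\<in>point_space n m q. u n I x * u n I' x = (\<Sum>(P, P')\<in>S. b P P' * u n P x * u n P' x))"
proof -
  have idx: "I \<in> index_tuples n m" "I' \<in> index_tuples n m" using assms by (auto simp: H_u_def)
  from tuple_straightening_equal_length[OF this, where ?'a = 'k]
  obtain S and b :: "nat list \<times> nat list \<Rightarrow> 'k" where S: "finite S" "S \<subseteq> index_tuples n m \<times> index_tuples n m"
    "\<forall>s\<in>S. b s \<noteq> 0 \<and> fst s \<succeq> I \<and> fst s \<succeq> I' \<and> I \<succeq> snd s \<and> I' \<succeq> snd s"
    and sum: "\<forall>w. tuple_minor w I * tuple_minor w I' =
      (\<Sum>s\<in>S. b s * (tuple_minor w (fst s) * tuple_minor w (snd s)))" by blast
  have "u n I x * u n I' x = (\<Sum>(P, P')\<in>S. b (P, P') * u n P x * u n P' x)" for x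
    unfolding u_eq_tuple_minor[OF idx(1)] u_eq_tuple_minor[OF idx(2)] sum[rule_format]
    using S(2) by (intro sum.cong) (auto simp: u_eq_tuple_minor mult.assoc)
  then show ?thesis using S
    by (intro exI[of _ S] exI[of _ "\<lambda>P P'. b (P, P')"]) (auto simp: H_u_def)
qed

lemma xi_straightening:
  assumes "J \<in> H_xi n q" and "J' \<in> H_xi n q"
  shows "\<exists>S (c :: nat list \<Rightarrow> nat list \<Rightarrow> 'k::idom). finite S \<and> S \<subseteq> H_xi n q \<times> H_xi n q \<and>
    (\<forall>(P, P')\<in>S. c P P' \<noteq> 0 \<and> P \<succeq> J \<and> P \<succeq> J' \<and> J \<succeq> P' \<and> J' \<succeq> P') \<and>
    (\<forall>x\<in>point_space n m q. \<xi> n J x * \<xi> n J' x = (\<Sum>(P, P')\<in>S. c P P' * \<xi> n P x * \<xi> n P' x))"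
proof -
  have idx: "J \<in> index_tuples n q" "J' \<in> index_tuples n q" using assms by (auto simp: H_xi_def)
  from tuple_straightening_equal_length[OF this, where ?'a = 'k]
  obtain S and c :: "nat list \<times> nat list \<Rightarrow> 'k" where S: "finite S" "S \<subseteq> index_tuples n q \<times> index_tuples n q"
    "\<forall>s\<in>S. c s \<noteq> 0 \<and> fst s \<succeq> J \<and> fst s \<succeq> J' \<and> J \<succeq> snd s \<and> J' \<succeq> snd s"
    and sum: "\<forall>w. tuple_minor w J * tuple_minor w J' =
      (\<Sum>s\<in>S. c s * (tuple_minor w (fst s) * tuple_minor w (snd s)))" by blast
  have "\<xi> n J x * \<xi> n J' x = (\<Sum>(P, P')\<in>S. c (P, P') * \<xi> n P x * \<xi> n P' x)" for x
    unfolding xi_eq_tuple_minor[OF idx(1)] xi_eq_tuple_minor[OF idx(2)] sum[rule_format]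
    using S(2) by (intro sum.cong) (auto simp: xi_eq_tuple_minor mult.assoc)
  then show ?thesis using S
    by (intro exI[of _ S] exI[of _ "\<lambda>P P'. c (P, P')"]) (auto simp: H_xi_def)
qed

lemma H_pD:
  assumes "(A, B) \<in> H_p n m q"
  shows "1 \<le> length A" "length A \<le> n" "A \<in> index_tuples (length A) m" "B \<in> index_tuples (length A) q"
proof -
  obtain r where r: "r \<in> {1..n}" "A \<in> index_tuples r m" "B \<in> index_tuples r q"
    using assms unfolding H_p_def by blast
  then have "length A = r" by (simp add: index_tuples_def)
  then show "1 \<le> length A" "length A \<le> n" "A \<in> index_tuples (length A) m" "B \<in> index_tuples (length A) q"
    using r by simp_all
qed

lemma H_pI:
  assumes "1 \<le> r" and "r \<le> n" and "A \<in> index_tuples r m" and "B \<in> index_tuples r q"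
  shows "(A, B) \<in> H_p n m q"
  unfolding H_p_def using assms by (intro UN_I[of r]) simp_all

text \<open>
Summands whose second factor has size greater than \<open>n\<close> vanish on \<open>X\<close> and are discarded. The bounds
keep the remaining second factors nonempty and the first factors of size at most \<open>n\<close>.
\<close>

lemma p_straightening:
  assumes A: "(A1, A2) \<in> H_p n m q" and B: "(B1, B2) \<in> H_p n m q"
  shows "\<exists>S (a :: nat list \<times> nat list \<Rightarrow> nat list \<times> nat list \<Rightarrow> 'k::idom).
    finite S \<and> S \<subseteq> (H_p n m q \<union> {([], [])}) \<times> H_p n m q \<and>
    (\<forall>((C1, C2), (D1, D2))\<in>S. a (C1, C2) (D1, D2) \<noteq> 0 \<and>
       C1 \<succeq> A1 \<and> C1 \<succeq> B1 \<and> A1 \<succeq> D1 \<and> B1 \<succeq> D1 \<and>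
       C2 \<succeq> A2 \<and> C2 \<succeq> B2 \<and> A2 \<succeq> D2 \<and> B2 \<succeq> D2) \<and>
    (\<forall>x\<in>point_space n m q. p A1 A2 x * p B1 B2 x =
       (\<Sum>((C1, C2), (D1, D2))\<in>S. a (C1, C2) (D1, D2) * p C1 C2 x * p D1 D2 x))"
proof -
  from block_minor_straightening[OF H_pD(3,4)[OF A] H_pD(3,4)[OF B], where ?'a = 'k]
  obtain S and a :: "(nat list \<times> nat list) \<times> (nat list \<times> nat list) \<Rightarrow> 'k" where fin: "finite S"
    and S: "\<forall>((C1, C2), (D1, D2))\<in>S. a ((C1, C2), (D1, D2)) \<noteq> 0 \<and>
       C1 \<in> index_tuples (length C1) m \<and> C2 \<in> index_tuples (length C1) q \<and>
       D1 \<in> index_tuples (length D1) m \<and> D2 \<in> index_tuples (length D1) q \<and>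
       C1 \<succeq> A1 \<and> C1 \<succeq> B1 \<and> A1 \<succeq> D1 \<and> B1 \<succeq> D1 \<and>
       C2 \<succeq> A2 \<and> C2 \<succeq> B2 \<and> A2 \<succeq> D2 \<and> B2 \<succeq> D2"
    and sum: "\<forall>Z. block_minor Z A1 A2 * block_minor Z B1 B2 =
       (\<Sum>((C1, C2), (D1, D2))\<in>S. a ((C1, C2), (D1, D2)) * (block_minor Z C1 C2 * block_minor Z D1 D2))"
    by blast
  define S' where "S' = {s \<in> S. length (fst (snd s)) \<le> n}"
  have "(C1, C2) \<in> H_p n m q \<union> {([], [])} \<and> (D1, D2) \<in> H_p n m q"
    if "((C1, C2), (D1, D2)) \<in> S'" for C1 C2 D1 D2
  proof -
    have in_S: "((C1, C2), (D1, D2)) \<in> S" and D_le: "length D1 \<le> n" using that by (auto simp: S'_def)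
    have C: "C1 \<in> index_tuples (length C1) m" "C2 \<in> index_tuples (length C1) q" "C1 \<succeq> A1"
      and D: "D1 \<in> index_tuples (length D1) m" "D2 \<in> index_tuples (length D1) q" "A1 \<succeq> D1"
      using bspec[OF S in_S] by auto
    have "length A1 \<le> length D1" "length C1 \<le> length A1" using C D by (auto simp: tuple_ge_def)
    then have "(D1, D2) \<in> H_p n m q" and C_le: "length C1 \<le> n"
      using H_pD(1,2)[OF A] D D_le by (auto intro!: H_pI[of "length D1"])
    moreover have "(C1, C2) \<in> H_p n m q \<union> {([], [])}"
    proof (cases "C1 = []")
      case True
      then show ?thesis using C(2) by (simp add: index_tuples_def)
    next
      case False
      then have "1 \<le> length C1" by (simp add: Suc_le_eq)
      then show ?thesis using C C_le by (auto intro!: H_pI[of "length C1"])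
    qed
    ultimately show ?thesis by blast
  qed
  then have sub: "S' \<subseteq> (H_p n m q \<union> {([], [])}) \<times> H_p n m q" by auto
  have "\<forall>x\<in>point_space n m q. p A1 A2 x * p B1 B2 x =
      (\<Sum>((C1, C2), (D1, D2))\<in>S'. a ((C1, C2), (D1, D2)) * p C1 C2 x * p D1 D2 x)"
  proof
    fix x assume x: "x \<in> (point_space n m q :: 'k point set)"
    have zero: "(\<lambda>((C1, C2), (D1, D2)). a ((C1, C2), (D1, D2)) * (p C1 C2 x * p D1 D2 x)) s = 0"
      if s: "s \<in> S - S'" for s
    proof -
      obtain C1 C2 D1 D2 where s_eq: "s = ((C1, C2), (D1, D2))" by (metis surj_pair)
      then have "p D1 D2 x = 0"
        using s bspec[OF S, of s] by (intro p_eq_0[OF x, of D1 "length D1"]) (auto simp: S'_def)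
      then show ?thesis by (simp add: s_eq)
    qed
    have "p A1 A2 x * p B1 B2 x =
        (\<Sum>((C1, C2), (D1, D2))\<in>S. a ((C1, C2), (D1, D2)) * (p C1 C2 x * p D1 D2 x))"
      unfolding p_eq_block_minor by (rule sum[rule_format])
    also have "\<dots> = (\<Sum>((C1, C2), (D1, D2))\<in>S'. a ((C1, C2), (D1, D2)) * (p C1 C2 x * p D1 D2 x))"
      using fin zero by (intro sum.mono_neutral_right) (auto simp: S'_def)
    finally show "p A1 A2 x * p B1 B2 x =
        (\<Sum>((C1, C2), (D1, D2))\<in>S'. a ((C1, C2), (D1, D2)) * p C1 C2 x * p D1 D2 x)"
      by (simp only: mult.assoc)
  qed
  moreover have "\<forall>((C1, C2), (D1, D2))\<in>S'. a ((C1, C2), (D1, D2)) \<noteq> 0 \<and>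
       C1 \<succeq> A1 \<and> C1 \<succeq> B1 \<and> A1 \<succeq> D1 \<and> B1 \<succeq> D1 \<and>
       C2 \<succeq> A2 \<and> C2 \<succeq> B2 \<and> A2 \<succeq> D2 \<and> B2 \<succeq> D2"
  proof
    fix s assume s: "s \<in> S'"
    obtain C1 C2 D1 D2 where s_eq: "s = ((C1, C2), (D1, D2))" by (metis surj_pair)
    then show "(\<lambda>((C1, C2), (D1, D2)). a ((C1, C2), (D1, D2)) \<noteq> 0 \<and>
       C1 \<succeq> A1 \<and> C1 \<succeq> B1 \<and> A1 \<succeq> D1 \<and> B1 \<succeq> D1 \<and>
       C2 \<succeq> A2 \<and> C2 \<succeq> B2 \<and> A2 \<succeq> D2 \<and> B2 \<succeq> D2) s"
      using s bspec[OF S, of s] by (simp add: S'_def)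
  qed
  moreover have "finite S'" using fin by (simp add: S'_def)
  ultimately show ?thesis using sub
    by (intro exI[of _ S'] exI[of _ "\<lambda>C D. a (C, D)"] conjI)
qed

text \<open>
The linear map given by the columns in \<open>B\<close> is the same in all summands, so that \<open>B' = B\<close> throughout.
\<close>

lemma p_u_straightening:
  assumes I: "I \<in> H_u n m" and AB: "(A, B) \<in> H_p n m q"
  shows "\<exists>S (d :: nat list \<times> nat list \<Rightarrow> nat list \<Rightarrow> 'k::idom). finite S \<and> S \<subseteq> H_p n m q \<times> H_u n m \<and>
    (\<forall>((A', B'), I')\<in>S. d (A', B') I' \<noteq> 0 \<and>
       A' \<succeq> A \<and> A' \<succeq> I \<and> A \<succeq> I' \<and> I \<succeq> I' \<and> B' \<succeq> B) \<and>
    (\<forall>x\<in>point_space n m q. p A B x * u n I x =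
       (\<Sum>((A', B'), I')\<in>S. d (A', B') I' * p A' B' x * u n I' x))"
proof -
  define r where "r = length A"
  have idx: "A \<in> index_tuples r m" "B \<in> index_tuples r q" "I \<in> index_tuples n m" and r: "1 \<le> r" "r \<le> n"
    using H_pD[OF AB] I unfolding r_def H_u_def by blast+
  from tuple_straightening[OF idx(1,3) r(2), where ?'a = 'k]
  obtain S and b :: "nat list \<times> nat list \<Rightarrow> 'k" where S: "finite S" "S \<subseteq> index_tuples r m \<times> index_tuples n m"
    "\<forall>s\<in>S. b s \<noteq> 0 \<and> fst s \<succeq> A \<and> fst s \<succeq> I \<and> A \<succeq> snd s \<and> I \<succeq> snd s"
    and sum: "\<forall>w V. tuple_minor (push n V w) A * tuple_minor w I =
      (\<Sum>s\<in>S. b s * (tuple_minor (push n V w) (fst s) * tuple_minor w (snd s)))" by blast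
  define S' where "S' = (\<lambda>(A', I'). ((A', B), I')) ` S"
  have inj: "inj_on (\<lambda>(A', I'). ((A', B), I')) S" by (auto simp: inj_on_def)
  have "\<forall>x\<in>point_space n m q. p A B x * u n I x =
      (\<Sum>((A', B'), I')\<in>S'. b (A', I') * p A' B' x * u n I' x)"
  proof
    fix x assume x: "x \<in> (point_space n m q :: 'k point set)"
    have "p A B x * u n I x = (\<Sum>(A', I')\<in>S. b (A', I') * p A' B x * u n I' x)"
      unfolding p_eq_row_minor[OF x idx(1,2)] u_eq_tuple_minor[OF idx(3)] sum[rule_format]
      using S(2) by (intro sum.cong) (auto simp: p_eq_row_minor[OF x _ idx(2)] u_eq_tuple_minor mult.assoc)
    then show "p A B x * u n I x = (\<Sum>((A', B'), I')\<in>S'. b (A', I') * p A' B' x * u n I' x)"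
      unfolding S'_def sum.reindex[OF inj] by (simp add: comp_def case_prod_beta)
  qed
  moreover have "finite S'" using S(1) by (simp add: S'_def)
  moreover have "S' \<subseteq> H_p n m q \<times> H_u n m"
    using S(2) H_pI[OF r _ idx(2)] by (auto simp: S'_def H_u_def)
  moreover have "\<forall>((A', B'), I')\<in>S'. b (A', I') \<noteq> 0 \<and>
      A' \<succeq> A \<and> A' \<succeq> I \<and> A \<succeq> I' \<and> I \<succeq> I' \<and> B' \<succeq> B"
    using S(3) by (auto simp: S'_def tuple_ge_def[of B B])
  ultimately show ?thesis
    by (intro exI[of _ S'] exI[of _ "\<lambda>AB I'. b (fst AB, I')"] conjI) (simp_all only: fst_conv)
qed

lemma p_xi_straightening:
  assumes J: "J \<in> H_xi n q" and AB: "(A, B) \<in> H_p n m q"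
  shows "\<exists>S (e :: nat list \<times> nat list \<Rightarrow> nat list \<Rightarrow> 'k::idom). finite S \<and> S \<subseteq> H_p n m q \<times> H_xi n q \<and>
    (\<forall>((A', B'), J')\<in>S. e (A', B') J' \<noteq> 0 \<and>
       A' \<succeq> A \<and> B' \<succeq> B \<and> B' \<succeq> J \<and> B \<succeq> J' \<and> J \<succeq> J') \<and>
    (\<forall>x\<in>point_space n m q. p A B x * \<xi> n J x =
       (\<Sum>((A', B'), J')\<in>S. e (A', B') J' * p A' B' x * \<xi> n J' x))"
proof -
  define r where "r = length A"
  have idx: "A \<in> index_tuples r m" "B \<in> index_tuples r q" "J \<in> index_tuples n q" and r: "1 \<le> r" "r \<le> n"
    using H_pD[OF AB] J unfolding r_def H_xi_def by blast+
  from tuple_straightening[OF idx(2,3) r(2), where ?'a = 'k]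
  obtain S and b :: "nat list \<times> nat list \<Rightarrow> 'k" where S: "finite S" "S \<subseteq> index_tuples r q \<times> index_tuples n q"
    "\<forall>s\<in>S. b s \<noteq> 0 \<and> fst s \<succeq> B \<and> fst s \<succeq> J \<and> B \<succeq> snd s \<and> J \<succeq> snd s"
    and sum: "\<forall>w V. tuple_minor (push n V w) B * tuple_minor w J =
      (\<Sum>s\<in>S. b s * (tuple_minor (push n V w) (fst s) * tuple_minor w (snd s)))" by blast
  define S' where "S' = (\<lambda>(B', J'). ((A, B'), J')) ` S"
  have inj: "inj_on (\<lambda>(B', J'). ((A, B'), J')) S" by (auto simp: inj_on_def)
  have "\<forall>x\<in>point_space n m q. p A B x * \<xi> n J x =
      (\<Sum>((A', B'), J')\<in>S'. b (B', J') * p A' B' x * \<xi> n J' x)"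
  proof
    fix x assume x: "x \<in> (point_space n m q :: 'k point set)"
    have "p A B x * \<xi> n J x = (\<Sum>(B', J')\<in>S. b (B', J') * p A B' x * \<xi> n J' x)"
      unfolding p_eq_column_minor[OF x idx(1,2)] xi_eq_tuple_minor[OF idx(3)] sum[rule_format]
      using S(2) by (intro sum.cong) (auto simp: p_eq_column_minor[OF x idx(1)] xi_eq_tuple_minor mult.assoc)
    then show "p A B x * \<xi> n J x = (\<Sum>((A', B'), J')\<in>S'. b (B', J') * p A' B' x * \<xi> n J' x)"
      unfolding S'_def sum.reindex[OF inj] by (simp add: comp_def case_prod_beta)
  qed
  moreover have "finite S'" using S(1) by (simp add: S'_def)
  moreover have "S' \<subseteq> H_p n m q \<times> H_xi n q"
    using S(2) H_pI[OF r idx(1)] by (auto simp: S'_def H_xi_def)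
  moreover have "\<forall>((A', B'), J')\<in>S'. b (B', J') \<noteq> 0 \<and>
      A' \<succeq> A \<and> B' \<succeq> B \<and> B' \<succeq> J \<and> B \<succeq> J' \<and> J \<succeq> J'"
    using S(3) by (auto simp: S'_def tuple_ge_def[of A A])
  ultimately show ?thesis
    by (intro exI[of _ S'] exI[of _ "\<lambda>AB J'. b (snd AB, J')"] conjI) (simp_all only: snd_conv)
qed

theorem theorem4p1p1:
  fixes n m q :: nat
    and X :: "'k::alg_closed_field point set"
  assumes "m > n" and "q > n"
    and X: "X = point_space n m q"
  shows
    \<comment> \<open>(1)\<close>
    "(\<forall>I \<in> H_u n m. \<forall>J \<in> H_xi n q. \<forall>x\<in>X. u n I x * \<xi> n J x = p I J x) \<and>
    \<comment> \<open>(2)\<close>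
     (\<forall>I \<in> H_u n m. \<forall>I' \<in> H_u n m. \<not> I \<succeq> I' \<and> \<not> I' \<succeq> I \<longrightarrow>
       (\<exists>S b. finite S \<and> S \<subseteq> H_u n m \<times> H_u n m \<and>
         (\<forall>(P, P')\<in>S. b P P' \<noteq> 0 \<and>
            P \<succeq> I \<and> P \<succeq> I' \<and> I \<succeq> P' \<and> I' \<succeq> P') \<and>
         (\<forall>x\<in>X. u n I x * u n I' x = (\<Sum>(P, P')\<in>S. b P P' * u n P x * u n P' x)))) \<and>
    \<comment> \<open>(3)\<close>
     (\<forall>J \<in> H_xi n q. \<forall>J' \<in> H_xi n q. \<not> J \<succeq> J' \<and> \<not> J' \<succeq> J \<longrightarrow>
       (\<exists>S c. finite S \<and> S \<subseteq> H_xi n q \<times> H_xi n q \<and>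
         (\<forall>(P, P')\<in>S. c P P' \<noteq> 0 \<and>
            P \<succeq> J \<and> P \<succeq> J' \<and> J \<succeq> P' \<and> J' \<succeq> P') \<and>
         (\<forall>x\<in>X. \<xi> n J x * \<xi> n J' x = (\<Sum>(P, P')\<in>S. c P P' * \<xi> n P x * \<xi> n P' x)))) \<and>
    \<comment> \<open>(4)\<close>
     (\<forall>(A1, A2) \<in> H_p n m q. \<forall>(B1, B2) \<in> H_p n m q.
       \<not> (A1, A2) \<succeq>\<^sub>p (B1, B2) \<and> \<not> (B1, B2) \<succeq>\<^sub>p (A1, A2) \<longrightarrow>
       (\<exists>S a. finite S \<and> S \<subseteq> (H_p n m q \<union> {([], [])}) \<times> H_p n m q \<and>
         (\<forall>((C1, C2), (D1, D2))\<in>S. a (C1, C2) (D1, D2) \<noteq> 0 \<and>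
            C1 \<succeq> A1 \<and> C1 \<succeq> B1 \<and> A1 \<succeq> D1 \<and> B1 \<succeq> D1 \<and>
            C2 \<succeq> A2 \<and> C2 \<succeq> B2 \<and> A2 \<succeq> D2 \<and> B2 \<succeq> D2) \<and>
         (\<forall>x\<in>X. p A1 A2 x * p B1 B2 x =
            (\<Sum>((C1, C2), (D1, D2))\<in>S. a (C1, C2) (D1, D2) * p C1 C2 x * p D1 D2 x)))) \<and>
    \<comment> \<open>(5)\<close>
     (\<forall>I \<in> H_u n m. \<forall>(A, B) \<in> H_p n m q. \<not> A \<succeq> I \<longrightarrow>
       (\<exists>S d. finite S \<and> S \<subseteq> H_p n m q \<times> H_u n m \<and>
         (\<forall>((A', B'), I')\<in>S. d (A', B') I' \<noteq> 0 \<and>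
            A' \<succeq> A \<and> A' \<succeq> I \<and> A \<succeq> I' \<and> I \<succeq> I' \<and> B' \<succeq> B) \<and>
         (\<forall>x\<in>X. p A B x * u n I x =
            (\<Sum>((A', B'), I')\<in>S. d (A', B') I' * p A' B' x * u n I' x)))) \<and>
    \<comment> \<open>(6)\<close>
     (\<forall>J \<in> H_xi n q. \<forall>(A, B) \<in> H_p n m q. \<not> B \<succeq> J \<longrightarrow>
       (\<exists>S e. finite S \<and> S \<subseteq> H_p n m q \<times> H_xi n q \<and>
         (\<forall>((A', B'), J')\<in>S. e (A', B') J' \<noteq> 0 \<and>
            A' \<succeq> A \<and> B' \<succeq> B \<and> B' \<succeq> J \<and> B \<succeq> J' \<and> J \<succeq> J') \<and>
         (\<forall>x\<in>X. p A B x * \<xi> n J x =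
            (\<Sum>((A', B'), J')\<in>S. e (A', B') J' * p A' B' x * \<xi> n J' x))))"
  unfolding X
  apply (intro conjI)
  subgoal by (intro ballI u_times_xi)
  subgoal by (intro ballI impI u_straightening)
  subgoal by (intro ballI impI xi_straightening)
  subgoal by (intro ballI case_prodI2 impI) (rule p_straightening; simp)
  subgoal by (intro ballI case_prodI2 impI) (rule p_u_straightening; simp)
  subgoal by (intro ballI case_prodI2 impI) (rule p_xi_straightening; simp)
  done

end
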